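(* Let $\mathcal{A}\in\mathbb{R}^{m\times n\times p}$, $\mathcal{B}\in\mathbb{R}^{m\times l\times p}$, let $T\subset\mathcal{P}([n])$ be a finite collection of column blocks such that $\mathcal{A}_{:\tau:}^*\mathcal{A}_{:\tau:}$ is invertible for every $\tau\in T$, and let $\mathcal{D}(T)$ be a probability distribution on $T$. Let $\mathcal{X}^{(k)}$ be the iterates of the TRBGS method (defined in the context) started from a fixed initial tensor $\mathcal{X}^{(0)}\in\mathbb{R}^{n\times l\times p}$, where the blocks $\tau_1,\tau_2,\dots$ are sampled independently from $\mathcal{D}(T)$. For $\tau\in T$ let $\mathcal{P}_{\mathcal{A}_{:\tau:}}:=\mathcal{A}_{:\tau:}(\mathcal{A}_{:\tau:}^*\mathcal{A}_{:\tau:})^{-1}\mathcal{A}_{:\tau:}^*$, and let $\mathcal{X}^\ddagger$ be a minimizer of $\|\mathcal{A}\mathcal{X}-\mathcal{B}\|_F^2$ over $\mathcal{X}\in\mathbb{R}^{n\times l\times p}$. Set $$\alpha_{\mathcal{A}}=1-\sigma_{\min}\big(\mathbb{E}_{\tau\sim\mathcal{D}(T)}[\mathrm{bcirc}(\mathcal{P}_{\mathcal{A}_{:\tau:}})]\big).$$ Then for every $k\ge 0$, $$\mathbb{E}\big[\|\mathcal{A}\mathcal{X}^{(k)}-\mathcal{A}\mathcal{X}^\ddagger\|_F^2\,\big|\,\mathcal{X}^{(0)}\big]\le \alpha_{\mathcal{A}}^k\,\|\mathcal{A}\mathcal{X}^{(0)}-\mathcal{A}\mathcal{X}^\ddagger\|_F^2.$$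 If, in addition, the system $\mathcal{A}\mathcal{X}=\mathcal{A}\mathcal{X}^\ddagger$ has the unique solution $\mathcal{X}=\mathcal{X}^\ddagger$, then for every $k\ge0$, $$\mathbb{E}\big[\|\mathcal{X}^{(k)}-\mathcal{X}^\ddagger\|_F^2\,\big|\,\mathcal{X}^{(0)}\big]\le \kappa^2(\mathcal{A})\,\alpha_{\mathcal{A}}^k\,\|\mathcal{X}^{(0)}-\mathcal{X}^\ddagger\|_F^2,$$ where $\kappa^2(\mathcal{A}):=\sigma_{\max}^2(\mathrm{bcirc}(\mathcal{A}^\dagger))\,\sigma_{\max}^2(\mathrm{bcirc}(\mathcal{A}))$. The expectations are over the random blocks.
   Context: All tensors are real third-order arrays. For $\mathcal{A}\in\mathbb{R}^{m\times n\times p}$ with frontal slices $\mathcal{A}_1,\dots,\mathcal{A}_p\in\mathbb{R}^{m\times n}$, $\mathrm{bcirc}(\mathcal{A})\in\mathbb{R}^{mp\times np}$ is the block-circulant matrix whose $(i,j)$ block ($i,j\in[p]$) is $\mathcal{A}_{((i-j)\bmod p)+1}$ (so its first block column is $\mathcal{A}_1,\mathcal{A}_2,\dots,\mathcal{A}_p$). For $\mathcal{B}\in\mathbb{R}^{n\times l\times p}$, $\mathrm{unfold}(\mathcal{B})\in\mathbb{R}^{np\times l}$ stacks the frontal slices $\mathcal{B}_1,\dots,\mathcal{B}_p$ vertically, and $\mathrm{fold}$ is its inverse. The t-product is $\mathcal{A}\mathcal{B}=\mathrm{fold}(\mathrm{bcirc}(\mathcal{A})\,\mathrm{unfold}(\mathcal{B}))\in\mathbb{R}^{m\times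 l\times p}$. The transpose $\mathcal{A}^*\in\mathbb{R}^{n\times m\times p}$ is obtained by transposing each frontal slice and reversing the order of the transposed slices $2$ through $p$ (so $\mathrm{bcirc}(\mathcal{A}^* )=\mathrm{bcirc}(\mathcal{A})^\top$). The identity tensor $\mathcal{I}\in\mathbb{R}^{n\times n\times p}$ has first frontal slice $I_n$ and all other slices zero; $\mathcal{C}$ is the inverse of a square tensor $\mathcal{A}$ if $\mathcal{A}\mathcal{C}=\mathcal{C}\mathcal{A}=\mathcal{I}$. The pseudoinverse $\mathcal{A}^\dagger$ is the tensor with $\mathrm{bcirc}(\mathcal{A}^\dagger)=\mathrm{bcirc}(\mathcal{A})^\dagger$ (Moore–Penrose pseudoinverse). $\|\cdot\|_F$ is the Frobenius norm (square root of the sum of squares of all entries). $\sigma_{\min}(\mathbf{M}),\sigma_{\max}(\mathbf{M})$ are the smallest and largest singular values of a matrix $\mathbf{M}$. For $\tau\subset[n]$, $\mathcal{A}_{:\tau:}\in\mathbb{R}^{m\times|\tau|\times p}$ consists of the lateral slices (columns) of $\mathcal{A}$ indexed by $\tau$, and $\mathcal{E}_\tau\in\mathbb{R}^{n\times|\tau|\times p}$ is the tensor whose first frontal slice consists of the columns of $I_n$ indexed by $\tau$ and whose other frontal slices are zero (so $\mathcal{A}\mathcal{E}_\tau=\mathcal{A}_{:\tau:}$). $\mathcal{P}([n])$ is the power set of $[n]=\{1,\dots,n\}$. TRBGS method: given $\mathcal{X}^{(0)}$, for $k=1,2,\dots$ sample $\tau_k$ and set $\mathcal{X}^{(k)}=\mathcal{X}^{(k-1)}-\mathcal{E}_{\tau_k}(\mathcal{A}_{:\tau_k:}^*\mathcal{A}_{:\tau_k:})^{-1}\mathcal{A}_{:\tau_k:}^*(\mathcal{A}\mathcal{X}^{(k-1)}-\mathcal{B})$.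 *)

theory Defs
  imports "Jordan_Normal_Form.Char_Poly" "HOL-Probability.Probability_Mass_Function"
begin

text \<open>A third-order real tensor is represented by the list of its frontal slices
  (each a real matrix). Indices are 0-based: the paper's index set [n] = {1..n}
  becomes {0..<n}.\<close>

type_synonym tensor = "real mat list"

definition is_tensor :: "tensor \<Rightarrow> nat \<Rightarrow> nat \<Rightarrow> nat \<Rightarrow> bool" where
  "is_tensor T m n p \<longleftrightarrow> length T = p \<and> (\<forall>S\<in>set T. S \<in> carrier_mat m n)"

definition bcirc :: "tensor \<Rightarrow> real mat" where
  "bcirc A = (let p = length A; m = dim_row (A ! 0); n = dim_col (A ! 0) in
     Matrix.mat (m * p) (n * p)
       (\<lambda>(r, c). (A ! ((r div m + p - c div n) mod p)) $$ (r mod m, c mod n)))"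

definition unfold_t :: "tensor \<Rightarrow> real mat" where
  "unfold_t B = (let p = length B; n = dim_row (B ! 0); l = dim_col (B ! 0) in
     Matrix.mat (n * p) l (\<lambda>(r, c). (B ! (r div n)) $$ (r mod n, c)))"

definition fold_t :: "real mat \<Rightarrow> nat \<Rightarrow> tensor" where
  "fold_t M p = (let n = dim_row M div p in
     map (\<lambda>k. Matrix.mat n (dim_col M) (\<lambda>(i, c). M $$ (k * n + i, c))) [0..<p])"

definition tprod :: "tensor \<Rightarrow> tensor \<Rightarrow> tensor" (infixl "\<star>" 70) where
  "A \<star> B = fold_t (bcirc A * unfold_t B) (length A)"

definition ttrans :: "tensor \<Rightarrow> tensor" where
  "ttrans A = map (\<lambda>k. transpose_mat (A ! ((length A - k) mod length A))) [0..<length A]"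

definition tadd :: "tensor \<Rightarrow> tensor \<Rightarrow> tensor" where
  "tadd A B = map2 (+) A B"

definition tsub :: "tensor \<Rightarrow> tensor \<Rightarrow> tensor" where
  "tsub A B = map2 (-) A B"

definition tid :: "nat \<Rightarrow> nat \<Rightarrow> tensor" where
  "tid n p = map (\<lambda>k. if k = 0 then 1\<^sub>m n else 0\<^sub>m n n) [0..<p]"

definition tinvertible :: "tensor \<Rightarrow> bool" where
  "tinvertible A \<longleftrightarrow> (\<exists>C. is_tensor C (dim_row (A ! 0)) (dim_row (A ! 0)) (length A) \<and>
      A \<star> C = tid (dim_row (A ! 0)) (length A) \<and> C \<star> A = tid (dim_row (A ! 0)) (length A))"

definition tinv :: "tensor \<Rightarrow> tensor" where
  "tinv A = (THE C. is_tensor C (dim_row (A ! 0)) (dim_row (A ! 0)) (length A) \<and>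
      A \<star> C = tid (dim_row (A ! 0)) (length A) \<and> C \<star> A = tid (dim_row (A ! 0)) (length A))"

definition sub_cols :: "tensor \<Rightarrow> nat set \<Rightarrow> tensor" where
  "sub_cols A \<tau> = map (\<lambda>S. Matrix.mat (dim_row S) (card \<tau>)
      (\<lambda>(i, j). S $$ (i, sorted_list_of_set \<tau> ! j))) A"

definition E_tau :: "nat \<Rightarrow> nat set \<Rightarrow> nat \<Rightarrow> tensor" where
  "E_tau n \<tau> p = map (\<lambda>k. if k = 0
      then Matrix.mat n (card \<tau>) (\<lambda>(i, j). if i = sorted_list_of_set \<tau> ! j then 1 else 0)
      else 0\<^sub>m n (card \<tau>)) [0..<p]"

definition fro2 :: "tensor \<Rightarrow> real" where
  "fro2 T = (\<Sum>S\<leftarrow>T. \<Sum>i<dim_row S. \<Sum>j<dim_col S. (S $$ (i, j))\<^sup>2)"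

definition pinv :: "real mat \<Rightarrow> real mat" where
  "pinv M = (THE G. G \<in> carrier_mat (dim_col M) (dim_row M) \<and>
     M * G * M = M \<and> G * M * G = G \<and>
     transpose_mat (M * G) = M * G \<and> transpose_mat (G * M) = G * M)"

text \<open>Singular values: square roots of the eigenvalues of M^T M (if M has at least
  as many rows as columns) resp. of M M^T (otherwise), i.e. the min(rows,cols)
  singular values.\<close>
definition gram :: "real mat \<Rightarrow> real mat" where
  "gram M = (if dim_col M \<le> dim_row M then transpose_mat M * M else M * transpose_mat M)"

definition sigma_min :: "real mat \<Rightarrow> real" where
  "sigma_min M = sqrt (Min {e. eigenvalue (gram M) e})"

definition sigma_max :: "real mat \<Rightarrow> real" where
  "sigma_max M = sqrt (Max {e. eigenvalue (gram M) e})"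

definition proj_t :: "tensor \<Rightarrow> nat set \<Rightarrow> tensor" where
  "proj_t A \<tau> = (let A\<tau> = sub_cols A \<tau> in A\<tau> \<star> (tinv (ttrans A\<tau> \<star> A\<tau>) \<star> ttrans A\<tau>))"

definition trbgs_step :: "tensor \<Rightarrow> tensor \<Rightarrow> tensor \<Rightarrow> nat set \<Rightarrow> tensor" where
  "trbgs_step A B X \<tau> = (let A\<tau> = sub_cols A \<tau>; n = dim_col (A ! 0); p = length A in
     tsub X (E_tau n \<tau> p \<star> (tinv (ttrans A\<tau> \<star> A\<tau>) \<star> (ttrans A\<tau> \<star> tsub (A \<star> X) B))))"

fun trbgs_dist :: "tensor \<Rightarrow> tensor \<Rightarrow> nat set pmf \<Rightarrow> tensor \<Rightarrow> nat \<Rightarrow> tensor pmf" where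
  "trbgs_dist A B D X0 0 = return_pmf X0"
| "trbgs_dist A B D X0 (Suc k) =
     bind_pmf (trbgs_dist A B D X0 k) (\<lambda>X. map_pmf (\<lambda>\<tau>. trbgs_step A B X \<tau>) D)"

definition exp_bcirc_proj :: "tensor \<Rightarrow> nat set pmf \<Rightarrow> real mat" where
  "exp_bcirc_proj A D = (let N = dim_row (A ! 0) * length A in
     Matrix.mat N N (\<lambda>ij. measure_pmf.expectation D (\<lambda>\<tau>. bcirc (proj_t A \<tau>) $$ ij)))"

end

(*
  The tensor problem is an ordinary least squares problem for M = bcirc A with right-hand side
  unfold B. With R = M (X - X_dd), one block step replaces R by R - P R, where P = bcirc (proj_t A tau)
  is an orthogonal projection; the residual M X_dd - B drops out because it is orthogonal to the
  range of M by the normal equations. Hence |R - P R|^2 = |R|^2 - <R, P R>, and averaging over tau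
  turns <R, P R> into <R, E[P] R>, which is at least sigma_min(E[P]) |R|^2 by the Rayleigh quotient.
  If the solution is unique then M is injective and pinv M is a left inverse of M, so the errors of
  X and of A X are comparable, which costs the factor sigma_max(pinv M)^2 sigma_max(M)^2.
*)
theory Submission
  imports Defs
begin

subsection \<open>The t-product as multiplication of block-circulant matrices\<close>

text \<open>Two spectral facts carry the estimate: the least Rayleigh quotient of a symmetric matrix
  is an eigenvalue, and so is the largest. Both are obtained variationally, from compactness of the
  sphere and a first-order condition; the same condition yields the normal equations. The mean E[P]
  is in general no projection, only symmetric with 0 \<le> E[P] \<le> I. The upper bound matters as
  well as the lower one: the induction over k multiplies by alpha and so needs alpha \<ge> 0, which
  says that \<open>sigma_min\<close> is at most 1. For an empty matrix \<open>sigma_min\<close> is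
  an unspecified value, so m = 0 is settled separately by noting that the residual vanishes. For l =
  0 uniqueness of the solution says nothing about the kernel of M, but then the error itself
  vanishes. Since \<open>tinv\<close> and \<open>pinv\<close> are definite descriptions, each needs
  a uniqueness proof before its defining equations can be used.\<close>

lemma sum_block:
  fixes f :: "nat \<Rightarrow> 'a::comm_monoid_add"
  shows "(\<Sum>r<n * p. f r) = (\<Sum>a<p. \<Sum>i<n. f (a * n + i))"
proof -
  have "(\<Sum>a<p. \<Sum>i<n. f (a * n + i)) = (\<Sum>a<p. sum f {a * n..<a * n + n})"
  proof (rule sum.cong[OF refl])
    fix a
    show "(\<Sum>i<n. f (a * n + i)) = sum f {a * n..<a * n + n}"
      using sum.shift_bounds_nat_ivl[of f 0 "a * n" n]
      by (simp add: lessThan_atLeast0 add.commute)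
  qed
  also have "\<dots> = (\<Sum>r<p * n. f r)" by (rule sum.nat_group)
  finally show ?thesis by (simp add: mult.commute)
qed

lemma block_index_less:
  fixes a :: nat assumes "a < p" "i < n" shows "a * n + i < n * p"
proof -
  have "a * n + i < Suc a * n" using assms by simp
  also have "\<dots> \<le> p * n" using assms by (intro mult_le_mono1) simp
  finally show ?thesis by (simp add: mult.commute)
qed

lemma block_index_cases:
  fixes r :: nat
  assumes "r < n * p"
  obtains a i where "a < p" "i < n" "r = a * n + i"
proof
  show "r div n < p" using assms by (simp add: less_mult_imp_div_less mult.commute)
  show "r mod n < n" using assms by (intro mod_less_divisor gr_zeroI) simp
  show "r = r div n * n + r mod n" by simp
qed

lemma block_mat_eqI:
  assumes "M \<in> carrier_mat (m * p) (n * q)" "N \<in> carrier_mat (m * p) (n * q)"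
    and "\<And>a i b j. a < p \<Longrightarrow> i < m \<Longrightarrow> b < q \<Longrightarrow> j < n \<Longrightarrow>
           M $$ (a * m + i, b * n + j) = N $$ (a * m + i, b * n + j)"
  shows "M = N"
proof (rule eq_matI)
  fix r c assume "r < dim_row N" "c < dim_col N"
  with assms have "r < m * p" "c < n * q" by auto
  then show "M $$ (r, c) = N $$ (r, c)"
    using assms(3) by (elim block_index_cases) simp
qed (use assms in auto)

text \<open>Adding p before subtracting avoids truncated subtraction of naturals. The value a + p -
  b stays below 2 p, so reduction removes p at most once.\<close>

lemma cyclic_diff:
  fixes a b p :: nat
  assumes "a < p" "b < p"
  shows "(a + p - b) mod p = (if b \<le> a then a - b else a + p - b)"
  using assms by (auto simp: mod_if)

text \<open>Shift invariance of cyclic differences, the property that makes a product of block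
  circulants block circulant again.\<close>

lemma cyclic_diff_diff:
  fixes a b s p :: nat
  assumes "a < p" "b < p" "s < p"
  shows "((a + p - b) mod p + p - (s + p - b) mod p) mod p = (a + p - s) mod p"
\<comment> \<open>In this case only the first difference wraps around, and the left-hand argument
  exceeds a + p - s by a full period.\<close>
proof (cases "a < b \<and> b \<le> s")
  case True
  then have "(a + p - b) mod p + p - (s + p - b) mod p = (a + p - s) + p"
    using assms by (simp add: cyclic_diff)
  then show ?thesis by simp
next
  case False
  then show ?thesis using assms by (auto simp: cyclic_diff)
qed

lemma is_tensorD:
  assumes "is_tensor A m n p"
  shows "length A = p" "\<And>k. k < p \<Longrightarrow> A ! k \<in> carrier_mat m n"
  using assms by (auto simp: is_tensor_def)

lemma is_tensorI:
  assumes "length A = p" "\<And>k. k < p \<Longrightarrow> A ! k \<in> carrier_mat m n"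
  shows "is_tensor A m n p"
  using assms by (auto simp: is_tensor_def in_set_conv_nth)

lemma tensor_eqI:
  assumes "is_tensor A m n p" "is_tensor B m n p"
    and "\<And>k i j. k < p \<Longrightarrow> i < m \<Longrightarrow> j < n \<Longrightarrow> A ! k $$ (i, j) = B ! k $$ (i, j)"
  shows "A = B"
proof (rule nth_equalityI)
  show "length A = length B" using is_tensorD(1) assms by metis
  fix k assume "k < length A"
  then have k: "k < p" using is_tensorD(1)[OF assms(1)] by simp
  show "A ! k = B ! k"
    using is_tensorD(2)[OF assms(1) k] is_tensorD(2)[OF assms(2) k] assms(3)[OF k]
    by (intro eq_matI) auto
qed

section \<open>Block-circulant matrices, unfolding and folding\<close>

lemma bcirc_carrier:
  assumes "0 < p" "is_tensor A m n p"
  shows "bcirc A \<in> carrier_mat (m * p) (n * p)"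
  using is_tensorD(1)[OF assms(2)] is_tensorD(2)[OF assms(2,1)] by (simp add: bcirc_def Let_def)

lemma bcirc_index:
  assumes "is_tensor A m n p" "a < p" "i < m" "b < p" "j < n"
  shows "bcirc A $$ (a * m + i, b * n + j) = A ! ((a + p - b) mod p) $$ (i, j)"
proof -
  have "0 < p" using assms by simp
  then show ?thesis
    using is_tensorD(1)[OF assms(1)] is_tensorD(2)[OF assms(1), of 0] assms
    by (simp add: bcirc_def Let_def block_index_less)
qed

text \<open>The first block column of \<open>bcirc A\<close> already lists every frontal slice. This
  carries uniqueness of inverses from matrices over to tensors.\<close>

lemma bcirc_inj:
  assumes "0 < p" "is_tensor A m n p" "is_tensor C m n p" "bcirc A = bcirc C"
  shows "A = C"
proof (rule tensor_eqI[OF assms(2,3)])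
  fix k i j assume "k < p" "i < m" "j < n"
  then show "A ! k $$ (i, j) = C ! k $$ (i, j)"
    using bcirc_index[OF assms(2), of k i 0 j] bcirc_index[OF assms(3), of k i 0 j] assms by simp
qed

lemma unfold_carrier:
  assumes "0 < p" "is_tensor X n l p"
  shows "unfold_t X \<in> carrier_mat (n * p) l"
  using is_tensorD(1)[OF assms(2)] is_tensorD(2)[OF assms(2,1)] by (simp add: unfold_t_def Let_def)

lemma unfold_index:
  assumes "is_tensor X n l p" "a < p" "i < n" "c < l"
  shows "unfold_t X $$ (a * n + i, c) = X ! a $$ (i, c)"
proof -
  have "0 < p" using assms by simp
  then show ?thesis
    using is_tensorD(1)[OF assms(1)] is_tensorD(2)[OF assms(1), of 0] assms
    by (simp add: unfold_t_def Let_def block_index_less)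
qed

lemma unfold_inj:
  assumes "is_tensor X n l p" "is_tensor Y n l p" "unfold_t X = unfold_t Y"
  shows "X = Y"
  by (rule tensor_eqI[OF assms(1,2)]) (use assms in \<open>metis unfold_index\<close>)

lemma unfold_eqI:
  assumes "0 < p" "is_tensor X n l p" "M \<in> carrier_mat (n * p) l"
    and "\<And>a i c. a < p \<Longrightarrow> i < n \<Longrightarrow> c < l \<Longrightarrow> X ! a $$ (i, c) = M $$ (a * n + i, c)"
  shows "unfold_t X = M"
proof (rule eq_matI)
  note c = unfold_carrier[OF assms(1,2)]
  fix r s assume "r < dim_row M" "s < dim_col M"
  with assms have rs: "r < n * p" "s < l" by auto
  from rs(1) obtain a i where "a < p" "i < n" "r = a * n + i" by (rule block_index_cases)
  then show "unfold_t X $$ (r, s) = M $$ (r, s)" using assms(4) unfold_index[OF assms(2)] rs(2) by simp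
qed (use assms unfold_carrier[OF assms(1,2)] in auto)

lemma fold_tensor:
  assumes "0 < p" "M \<in> carrier_mat (n * p) l"
  shows "is_tensor (fold_t M p) n l p"
  using assms by (intro is_tensorI) (auto simp: fold_t_def Let_def)

lemma fold_index:
  assumes "0 < p" "M \<in> carrier_mat (n * p) l" "a < p" "i < n" "c < l"
  shows "fold_t M p ! a $$ (i, c) = M $$ (a * n + i, c)"
  using assms by (auto simp: fold_t_def Let_def)

lemma unfold_fold:
  assumes "0 < p" "M \<in> carrier_mat (n * p) l"
  shows "unfold_t (fold_t M p) = M"
  by (rule unfold_eqI[OF assms(1) fold_tensor[OF assms] assms(2) fold_index[OF assms]])

section \<open>Product, transpose, identity and inverse of tensors in matrix form\<close>

lemma tprod_tensor:
  assumes "0 < p" "is_tensor A m n p" "is_tensor B n l p"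
  shows "is_tensor (A \<star> B) m l p"
  unfolding tprod_def is_tensorD(1)[OF assms(2)]
  by (rule fold_tensor[OF assms(1) mult_carrier_mat[OF bcirc_carrier[OF assms(1,2)] unfold_carrier[OF assms(1,3)]]])

lemma unfold_tprod:
  assumes "0 < p" "is_tensor A m n p" "is_tensor B n l p"
  shows "unfold_t (A \<star> B) = bcirc A * unfold_t B"
  unfolding tprod_def is_tensorD(1)[OF assms(2)]
  by (rule unfold_fold[OF assms(1) mult_carrier_mat[OF bcirc_carrier[OF assms(1,2)] unfold_carrier[OF assms(1,3)]]])

text \<open>Slice by slice, the t-product is the cyclic convolution of the two sequences of frontal
  slices, with matrix multiplication as the product.\<close>

lemma tprod_index:
  assumes "0 < p" "is_tensor A m n p" "is_tensor B n l p" "a < p" "i < m" "c < l"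
  shows "(A \<star> B) ! a $$ (i, c) =
    (\<Sum>s<p. \<Sum>t<n. A ! ((a + p - s) mod p) $$ (i, t) * B ! s $$ (t, c))"
proof -
  note carr = bcirc_carrier[OF assms(1,2)] unfold_carrier[OF assms(1,3)]
  have "(A \<star> B) ! a $$ (i, c) = (bcirc A * unfold_t B) $$ (a * m + i, c)"
    using unfold_index[OF tprod_tensor[OF assms(1-3)] assms(4-6)] unfold_tprod[OF assms(1-3)] by simp
  also have "\<dots> = (\<Sum>r<n * p. bcirc A $$ (a * m + i, r) * unfold_t B $$ (r, c))"
    using carr assms block_index_less[OF assms(4,5)]
    by (simp add: scalar_prod_def lessThan_atLeast0)
  also have "\<dots> = (\<Sum>s<p. \<Sum>t<n. A ! ((a + p - s) mod p) $$ (i, t) * B ! s $$ (t, c))"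
    unfolding sum_block using assms bcirc_index[OF assms(2)] unfold_index[OF assms(3)]
    by (intro sum.cong) auto
  finally show ?thesis .
qed

text \<open>Block (a, b) on the left is the convolution at a - b. Shifting its summation index by b,
  a bijection of the residues modulo p, turns it into block row a of \<open>bcirc A\<close> against
  block column b of \<open>bcirc B\<close>.\<close>

lemma bcirc_tprod:
  assumes "0 < p" "is_tensor A m n p" "is_tensor B n l p"
  shows "bcirc (A \<star> B) = bcirc A * bcirc B"
proof (rule block_mat_eqI)
  note carr = bcirc_carrier[OF assms(1,2)] bcirc_carrier[OF assms(1,3)]
  note AB = tprod_tensor[OF assms]
  show "bcirc (A \<star> B) \<in> carrier_mat (m * p) (l * p)" using bcirc_carrier[OF assms(1) AB] .
  show "bcirc A * bcirc B \<in> carrier_mat (m * p) (l * p)" using carr by auto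
  fix a i b j assume *: "a < p" "i < m" "b < p" "j < l"
  let ?d = "(a + p - b) mod p"
  let ?f = "\<lambda>s. \<Sum>t<n. A ! ((?d + p - s) mod p) $$ (i, t) * B ! s $$ (t, j)"
  have "bcirc (A \<star> B) $$ (a * m + i, b * l + j) = (\<Sum>s<p. ?f s)"
    using * assms by (simp add: bcirc_index[OF AB] tprod_index[OF assms])
  also have "\<dots> = (\<Sum>s<p. ?f ((s + p - b) mod p))"
  proof (rule sum.reindex_bij_witness[of _ "\<lambda>s. (s + p - b) mod p" "\<lambda>s. (s + b) mod p"])
    fix s assume s: "s \<in> {..<p}"
    then show "((s + b) mod p + p - b) mod p = s" "((s + p - b) mod p + b) mod p = s"
      using * by (auto simp: mod_if)
    then show "?f (((s + b) mod p + p - b) mod p) = ?f s" by simp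
  qed (use assms in auto)
  also have "\<dots> = (\<Sum>s<p. \<Sum>t<n. A ! ((a + p - s) mod p) $$ (i, t) * B ! ((s + p - b) mod p) $$ (t, j))"
  proof (intro sum.cong refl)
    fix s t assume "s \<in> {..<p}"
    then have "(?d + p - (s + p - b) mod p) mod p = (a + p - s) mod p"
      using * by (simp add: cyclic_diff_diff)
    then show "A ! ((?d + p - (s + p - b) mod p) mod p) $$ (i, t) * B ! ((s + p - b) mod p) $$ (t, j)
      = A ! ((a + p - s) mod p) $$ (i, t) * B ! ((s + p - b) mod p) $$ (t, j)" by simp
  qed
  also have "\<dots> = (\<Sum>r<n * p. bcirc A $$ (a * m + i, r) * bcirc B $$ (r, b * l + j))"
    unfolding sum_block using * assms bcirc_index[OF assms(2)] bcirc_index[OF assms(3)]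
    by (intro sum.cong) auto
  also have "\<dots> = (bcirc A * bcirc B) $$ (a * m + i, b * l + j)"
    using carr * block_index_less[OF *(1,2)] block_index_less[OF *(3,4)]
    by (simp add: scalar_prod_def lessThan_atLeast0)
  finally show "bcirc (A \<star> B) $$ (a * m + i, b * l + j) = (bcirc A * bcirc B) $$ (a * m + i, b * l + j)" .
qed

lemma ttrans_tensor:
  assumes "is_tensor A m n p"
  shows "is_tensor (ttrans A) n m p"
proof (rule is_tensorI)
  show "length (ttrans A) = p" using is_tensorD[OF assms] by (simp add: ttrans_def)
  fix k assume "k < p"
  then have "A ! ((p - k) mod p) \<in> carrier_mat m n" by (intro is_tensorD(2)[OF assms]) simp
  then show "ttrans A ! k \<in> carrier_mat n m"
    using \<open>k < p\<close> is_tensorD(1)[OF assms] by (simp add: ttrans_def)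
qed

text \<open>Transposition exchanges the block indices and so negates the slice number a - b modulo
  p; the reversal of slices in \<open>ttrans\<close> undoes exactly this.\<close>

lemma bcirc_ttrans:
  assumes "0 < p" "is_tensor A m n p"
  shows "bcirc (ttrans A) = transpose_mat (bcirc A)"
proof (rule block_mat_eqI)
  note AT = ttrans_tensor[OF assms(2)]
  show "bcirc (ttrans A) \<in> carrier_mat (n * p) (m * p)" using bcirc_carrier[OF assms(1) AT] .
  show "transpose_mat (bcirc A) \<in> carrier_mat (n * p) (m * p)" using bcirc_carrier[OF assms] by simp
  fix a i b j assume *: "a < p" "i < n" "b < p" "j < m"
  let ?d = "(a + p - b) mod p"
  have d: "?d < p" "(p - ?d) mod p = (b + p - a) mod p" using * assms(1) by (auto simp: cyclic_diff mod_if)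
  have "A ! ((p - ?d) mod p) \<in> carrier_mat m n"
    by (rule is_tensorD(2)[OF assms(2)]) (simp add: assms(1))
  then have "ttrans A ! ?d $$ (i, j) = A ! ((b + p - a) mod p) $$ (j, i)"
    using d * is_tensorD(1)[OF assms(2)] by (simp add: ttrans_def)
  then show "bcirc (ttrans A) $$ (a * n + i, b * m + j) = transpose_mat (bcirc A) $$ (a * n + i, b * m + j)"
    using * bcirc_carrier[OF assms] block_index_less[OF *(1,2)] block_index_less[OF *(3,4)]
    by (simp add: bcirc_index[OF AT] bcirc_index[OF assms(2)])
qed

lemma tid_tensor: "is_tensor (tid n p) n n p"
  by (rule is_tensorI) (auto simp: tid_def)

lemma bcirc_tid:
  assumes "0 < p"
  shows "bcirc (tid n p) = 1\<^sub>m (n * p)"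
proof (rule block_mat_eqI)
  show "bcirc (tid n p) \<in> carrier_mat (n * p) (n * p)" using bcirc_carrier[OF assms tid_tensor] .
  fix a i b j assume *: "a < p" "i < n" "b < p" "j < n"
  have "a * n + i = b * n + j \<longleftrightarrow> a = b \<and> i = j"
  proof
    assume "a * n + i = b * n + j"
    then have "(a * n + i) div n = (b * n + j) div n" "(a * n + i) mod n = (b * n + j) mod n" by auto
    then show "a = b \<and> i = j" using * by simp
  qed simp
  moreover have "(a + p - b) mod p = 0 \<longleftrightarrow> a = b" using * by (auto simp: cyclic_diff)
  moreover have "(a + p - b) mod p < p" using assms by simp
  ultimately show "bcirc (tid n p) $$ (a * n + i, b * n + j) = 1\<^sub>m (n * p) $$ (a * n + i, b * n + j)"
    using * block_index_less[OF *(1,2)] block_index_less[OF *(3,4)]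
    by (simp add: bcirc_index[OF tid_tensor]) (simp add: tid_def)
qed simp

text \<open>The definite description in \<open>tinv\<close> has a meaning only once the inverse is
  known to be unique: a left and a right inverse of \<open>bcirc C\<close> coincide, and
  \<open>bcirc\<close> is injective.\<close>

lemma tinv_props:
  assumes "0 < p" "is_tensor C n n p" "tinvertible C"
  shows "is_tensor (tinv C) n n p" "bcirc (tinv C) * bcirc C = 1\<^sub>m (n * p)"
    "bcirc C * bcirc (tinv C) = 1\<^sub>m (n * p)"
proof -
  let ?P = "\<lambda>G. is_tensor G n n p \<and> C \<star> G = tid n p \<and> G \<star> C = tid n p"
  have dims: "dim_row (C ! 0) = n" "length C = p"
    using is_tensorD(1)[OF assms(2)] is_tensorD(2)[OF assms(2,1)] by auto
  obtain G where G: "?P G" using assms(3) unfolding tinvertible_def dims by blast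
  have uniq: "H = G" if H: "?P H" for H
  proof (rule bcirc_inj[OF assms(1)])
    note c = bcirc_carrier[OF assms(1)]
    have "bcirc C \<in> carrier_mat (n * p) (n * p)" "bcirc G \<in> carrier_mat (n * p) (n * p)"
      "bcirc H \<in> carrier_mat (n * p) (n * p)" using c assms(2) G H by auto
    moreover have "bcirc C * bcirc G = 1\<^sub>m (n * p)" "bcirc H * bcirc C = 1\<^sub>m (n * p)"
      using G H bcirc_tprod[OF assms(1,2), of G n] bcirc_tprod[OF assms(1) _ assms(2), of H n] bcirc_tid[OF assms(1)]
      by auto
    ultimately show "bcirc H = bcirc G"
      by (metis assoc_mult_mat left_mult_one_mat right_mult_one_mat)
  qed (use G H in auto)
  have "?P (THE G. ?P G)" by (rule theI[of ?P, OF G uniq])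
  then have T: "?P (tinv C)" unfolding tinv_def dims .
  then show "is_tensor (tinv C) n n p" by simp
  show "bcirc (tinv C) * bcirc C = 1\<^sub>m (n * p)" "bcirc C * bcirc (tinv C) = 1\<^sub>m (n * p)"
    using T bcirc_tprod[OF assms(1,2), of "tinv C" n] bcirc_tprod[OF assms(1) _ assms(2), of "tinv C" n] bcirc_tid[OF assms(1)]
    by auto
qed

section \<open>Lateral slices, differences and the Frobenius norm\<close>

lemma sub_cols_tensor:
  assumes "is_tensor A m n p"
  shows "is_tensor (sub_cols A \<tau>) m (card \<tau>) p"
  using is_tensorD[OF assms] by (intro is_tensorI) (simp_all add: sub_cols_def carrier_matD(1)[OF is_tensorD(2)[OF assms]])

lemma E_tau_tensor: "is_tensor (E_tau n \<tau> p) n (card \<tau>) p"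
  by (intro is_tensorI) (auto simp: E_tau_def)

text \<open>Slice 0 is the only nonzero slice of \<open>E_tau\<close> and its columns are unit
  vectors, so both sums of the convolution collapse to a single term.\<close>

lemma tprod_E_tau:
  assumes "0 < p" "is_tensor A m n p" "\<tau> \<subseteq> {0..<n}"
  shows "A \<star> E_tau n \<tau> p = sub_cols A \<tau>"
proof (rule tensor_eqI[OF tprod_tensor[OF assms(1,2) E_tau_tensor] sub_cols_tensor[OF assms(2)]])
  fix k i c assume *: "k < p" "i < m" "c < card \<tau>"
  have fin: "finite \<tau>" using assms(3) finite_subset by blast
  let ?c = "sorted_list_of_set \<tau> ! c"
  have "?c \<in> \<tau>" using fin *(3) nth_mem[of c "sorted_list_of_set \<tau>"] by simp
  then have c: "?c < n" using assms(3) by auto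
  have "(A \<star> E_tau n \<tau> p) ! k $$ (i, c) =
    (\<Sum>s<p. \<Sum>t<n. A ! ((k + p - s) mod p) $$ (i, t) * E_tau n \<tau> p ! s $$ (t, c))"
    by (rule tprod_index[OF assms(1,2) E_tau_tensor *])
  also have "\<dots> = (\<Sum>s<p. if s = 0 then A ! k $$ (i, ?c) else 0)"
  proof (rule sum.cong[OF refl])
    fix s assume s: "s \<in> {..<p}"
    have "(\<Sum>t<n. A ! ((k + p - s) mod p) $$ (i, t) * E_tau n \<tau> p ! s $$ (t, c))
      = (\<Sum>t<n. if t = ?c then (if s = 0 then A ! ((k + p - s) mod p) $$ (i, t) else 0) else 0)"
      using s * by (intro sum.cong) (auto simp: E_tau_def)
    also have "\<dots> = (if s = 0 then A ! k $$ (i, ?c) else 0)" using c * by simp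
    finally show "(\<Sum>t<n. A ! ((k + p - s) mod p) $$ (i, t) * E_tau n \<tau> p ! s $$ (t, c))
      = (if s = 0 then A ! k $$ (i, ?c) else 0)" .
  qed
  also have "\<dots> = A ! k $$ (i, ?c)" using assms(1) by simp
  also have "\<dots> = sub_cols A \<tau> ! k $$ (i, c)"
    using * is_tensorD(1)[OF assms(2)] is_tensorD(2)[OF assms(2) *(1)] by (simp add: sub_cols_def)
  finally show "(A \<star> E_tau n \<tau> p) ! k $$ (i, c) = sub_cols A \<tau> ! k $$ (i, c)" .
qed

lemma tsub_tensor:
  assumes "is_tensor X n l p" "is_tensor Y n l p"
  shows "is_tensor (tsub X Y) n l p"
  using is_tensorD[OF assms(1)] is_tensorD[OF assms(2)]
  by (intro is_tensorI) (auto simp: tsub_def intro!: minus_carrier_mat)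

lemma unfold_tsub:
  assumes "0 < p" "is_tensor X n l p" "is_tensor Y n l p"
  shows "unfold_t (tsub X Y) = unfold_t X - unfold_t Y"
proof (rule unfold_eqI[OF assms(1) tsub_tensor[OF assms(2,3)]])
  note c = unfold_carrier[OF assms(1,2)] unfold_carrier[OF assms(1,3)]
  show "unfold_t X - unfold_t Y \<in> carrier_mat (n * p) l" using c by auto
  fix a i s assume *: "a < p" "i < n" "s < l"
  then show "tsub X Y ! a $$ (i, s) = (unfold_t X - unfold_t Y) $$ (a * n + i, s)"
    using c block_index_less[OF *(1,2)] unfold_index[OF assms(2) *] unfold_index[OF assms(3) *]
      is_tensorD(1)[OF assms(2)] is_tensorD(1)[OF assms(3)]
      is_tensorD(2)[OF assms(2) *(1)] is_tensorD(2)[OF assms(3) *(1)]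
    by (simp add: tsub_def)
qed

text \<open>The trace inner product tr(X^T Y). The summation ranges are read off X alone, which is
  why its symmetry below carries dimension hypotheses.\<close>

definition frob_inner :: "real mat \<Rightarrow> real mat \<Rightarrow> real" where
  "frob_inner X Y = (\<Sum>i<dim_row X. \<Sum>j<dim_col X. X $$ (i, j) * Y $$ (i, j))"

lemma fro2_unfold:
  assumes "0 < p" "is_tensor X n l p"
  shows "fro2 X = frob_inner (unfold_t X) (unfold_t X)"
proof -
  note c = unfold_carrier[OF assms]
  have "fro2 X = (\<Sum>a<p. \<Sum>i<dim_row (X ! a). \<Sum>j<dim_col (X ! a). (X ! a $$ (i, j))\<^sup>2)"
    using is_tensorD(1)[OF assms(2)]
    by (simp add: fro2_def sum_list_sum_nth lessThan_atLeast0)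
  also have "\<dots> = (\<Sum>a<p. \<Sum>i<n. \<Sum>j<l. (unfold_t X $$ (a * n + i, j))\<^sup>2)"
  proof (rule sum.cong[OF refl])
    fix a assume "a \<in> {..<p}"
    then show "(\<Sum>i<dim_row (X ! a). \<Sum>j<dim_col (X ! a). (X ! a $$ (i, j))\<^sup>2) = (\<Sum>i<n. \<Sum>j<l. (unfold_t X $$ (a * n + i, j))\<^sup>2)"
      using is_tensorD(2)[OF assms(2), of a] unfold_index[OF assms(2), of a] by auto
  qed
  also have "\<dots> = frob_inner (unfold_t X) (unfold_t X)"
    using c by (simp add: frob_inner_def sum_block power2_eq_square)
  finally show ?thesis .
qed

text \<open>Supplies the degenerate cases m = 0 and l = 0 of the final estimates.\<close>

lemma fro2_empty:
  assumes "0 < p" "is_tensor X n l p" "n = 0 \<or> l = 0"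
  shows "fro2 X = 0"
  using unfold_carrier[OF assms(1,2)] assms(3) by (auto simp: fro2_unfold[OF assms(1,2)] frob_inner_def)

subsection \<open>Rayleigh quotients, singular values and least squares\<close>

text \<open>A first-order optimality condition without derivatives: for small t the linear term
  dominates, and its sign can be chosen by that of t. It serves the Rayleigh quotient and the least
  squares problem alike.\<close>

lemma linear_term_zero:
  fixes c d :: real
  assumes "\<And>t. 0 \<le> 2 * t * d + t\<^sup>2 * c"
  shows "d = 0"
proof (rule ccontr)
  assume d: "d \<noteq> 0"
  \<comment> \<open>A positive upper bound for c; the test point t = - d / s then makes the
    expression at most - d^2 / s.\<close>
  define s where "s = \<bar>c\<bar> + 1"
  have s: "s > 0" "c \<le> s" by (auto simp: s_def)
  have "2 * (- d / s) * d + (- d / s)\<^sup>2 * c \<le> 2 * (- d / s) * d + (- d / s)\<^sup>2 * s"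
    using s by (intro add_left_mono mult_left_mono) auto
  also have "\<dots> = - (d\<^sup>2 / s)" using s by (simp add: field_simps power2_eq_square)
  also have "\<dots> < 0" using s d by simp
  finally show False using assms[of "- d / s"] by linarith
qed

section \<open>Extremal Rayleigh quotients of symmetric matrices\<close>

lemma scalar_prod_self_nonneg: "0 \<le> scalar_prod x (x :: real Matrix.vec)"
  by (auto simp: scalar_prod_def intro: sum_nonneg)

lemma scalar_prod_self_eq_0:
  assumes "x \<in> carrier_vec n" "scalar_prod x (x :: real Matrix.vec) = 0"
  shows "x = 0\<^sub>v n"
proof (rule eq_vecI)
  fix i assume "i < dim_vec (0\<^sub>v n :: real Matrix.vec)"
  with assms have "\<forall>i\<in>{0..<n}. vec_index x i * vec_index x i = 0" "i < n"
    by (auto simp: scalar_prod_def sum_nonneg_eq_0_iff)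
  then show "vec_index x i = vec_index (0\<^sub>v n) i" by auto
qed (use assms in auto)

lemma symmetric_scalar_prod:
  fixes Q :: "real mat"
  assumes "Q \<in> carrier_mat n n" "transpose_mat Q = Q" "x \<in> carrier_vec n" "y \<in> carrier_vec n"
  shows "scalar_prod x (Q *\<^sub>v y) = scalar_prod y (Q *\<^sub>v x)"
proof -
  have "scalar_prod y (Q *\<^sub>v x) = scalar_prod (Q *\<^sub>v x) y"
    using assms by (intro comm_scalar_prod[of _ n]) auto
  also have "\<dots> = scalar_prod x (Q *\<^sub>v y)"
    using transpose_vec_mult_scalar[OF assms(1,4,3)] assms
    by (metis comm_scalar_prod mult_mat_vec_carrier transpose_vec_mult_scalar)
  finally show ?thesis by simp
qed

text \<open>A continuous form attains its minimum on the compact unit sphere, and homogeneity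
  extends the bound to all vectors. Vectors are modelled as functions on \<open>nat\<close>, where
  the product topology is at hand.\<close>

lemma rayleigh_minimizer:
  fixes Q :: "real mat"
  assumes N: "0 < N" and Q: "Q \<in> carrier_mat N N"
  obtains \<mu> v where "v \<in> carrier_vec N" "scalar_prod v v = 1" "scalar_prod v (Q *\<^sub>v v) = \<mu>"
    "\<And>x. x \<in> carrier_vec N \<Longrightarrow> \<mu> * scalar_prod x x \<le> scalar_prod x (Q *\<^sub>v x)"
proof -
  define q where "q f = (\<Sum>i<N. \<Sum>j<N. f i * (Q $$ (i, j) * f j))" for f :: "nat \<Rightarrow> real"
  define s where "s f = (\<Sum>i<N. f i * f i)" for f :: "nat \<Rightarrow> real"
  have q: "q f = scalar_prod (Matrix.vec N f) (Q *\<^sub>v Matrix.vec N f)" for f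
    using Q by (simp add: q_def scalar_prod_def lessThan_atLeast0 sum_distrib_left)
  have s: "s f = scalar_prod (Matrix.vec N f) (Matrix.vec N f)" for f
    by (simp add: s_def scalar_prod_def lessThan_atLeast0)
  \<comment> \<open>Coordinates from N on stay free in [-1, 1]: \<open>q\<close> and
    \<open>s\<close> ignore them, and \<open>C\<close> remains a full product of compact
    intervals.\<close>
  define C where "C = (PiE UNIV (\<lambda>_. {-1..1}) :: (nat \<Rightarrow> real) set)"
  define K where "K = C \<inter> {f. s f = 1}"
  have "compactin (product_topology (\<lambda>_::nat. euclidean :: real topology) UNIV) C"
    unfolding C_def by (simp add: compactin_PiE)
  then have "compact C" by (simp add: euclidean_product_topology)
  moreover have cont_s: "continuous_on UNIV s"
    unfolding s_def by (intro continuous_intros continuous_on_product_coordinates)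
  moreover have cont_q: "continuous_on UNIV q"
    unfolding q_def by (intro continuous_intros continuous_on_product_coordinates)
  moreover have "closed {f. s f = 1}"
    by (rule closed_Collect_eq[OF cont_s continuous_on_const])
  ultimately have "compact K" unfolding K_def by (intro compact_Int_closed)
  \<comment> \<open>The first unit vector shows that the sphere is nonempty; this uses N >
    0.\<close>
  moreover have "(\<lambda>i. if i = 0 then 1 else 0) \<in> K"
    using N by (auto simp: K_def C_def s_def if_distrib sum.delta cong: if_cong)
  moreover have "continuous_on K q" using cont_q continuous_on_subset by blast
  ultimately obtain f where f: "f \<in> K" "\<And>g. g \<in> K \<Longrightarrow> q f \<le> q g"
    using continuous_attains_inf[of K q] by blast
  show thesis
  proof
    show "scalar_prod (Matrix.vec N f) (Matrix.vec N f) = 1" using f(1) s by (simp add: K_def)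
    show "scalar_prod (Matrix.vec N f) (Q *\<^sub>v Matrix.vec N f) = q f" by (simp add: q)
    fix x :: "real Matrix.vec" assume x: "x \<in> carrier_vec N"
    show "q f * scalar_prod x x \<le> scalar_prod x (Q *\<^sub>v x)"
    proof (cases "scalar_prod x x = 0")
      case True
      then have "x = 0\<^sub>v N" using scalar_prod_self_eq_0 x by blast
      then show ?thesis using Q by simp
    next
      case False
      define r where "r = sqrt (scalar_prod x x)"
      have r: "r > 0" "r * r = scalar_prod x x"
        using False scalar_prod_self_nonneg[of x] by (auto simp: r_def less_le)
      \<comment> \<open>The normalized x, padded by 0. Its coordinates lie in [-1, 1] because each
        square is bounded by the squared norm 1.\<close>
      define g where "g i = (if i < N then vec_index x i / r else 0)" for i
      have g: "Matrix.vec N g = (1 / r) \<cdot>\<^sub>v x" using x by (intro eq_vecI) (auto simp: g_def)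
      have sg: "s g = 1" using r x False by (simp add: s g)
      have "g i \<in> {-1..1}" for i
      proof (cases "i < N")
        case True
        have "g i * g i \<le> s g" unfolding s_def using True by (intro member_le_sum) auto
        then have "(g i)\<^sup>2 \<le> 1" using sg by (simp add: power2_eq_square)
        then show ?thesis using abs_square_le_1[of "g i"] by (simp add: abs_le_iff)
      qed (simp add: g_def)
      then have "g \<in> K" using sg by (auto simp: K_def C_def)
      then have "q f \<le> q g" by (rule f(2))
      also have "q g = scalar_prod x (Q *\<^sub>v x) / (r * r)"
        unfolding q g using x Q by (simp add: mult_mat_vec[OF Q x])
      finally show ?thesis using r False scalar_prod_self_nonneg[of x]
        by (simp add: pos_le_divide_eq less_le)
    qed
  qed simp
qed

text \<open>The form x^T Q x - \<mu> x^T x is nonnegative and vanishes at the minimizer v, so its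
  gradient vanishes there; for symmetric Q that is the eigenvector equation.\<close>

lemma rayleigh_min_eigenvalue:
  fixes Q :: "real mat"
  assumes N: "0 < N" and Q: "Q \<in> carrier_mat N N" and sym: "transpose_mat Q = Q"
  obtains \<mu> where "eigenvalue Q \<mu>"
    "\<And>x. x \<in> carrier_vec N \<Longrightarrow> \<mu> * scalar_prod x x \<le> scalar_prod x (Q *\<^sub>v x)"
proof -
  obtain \<mu> v where v: "v \<in> carrier_vec N" "scalar_prod v v = 1" "scalar_prod v (Q *\<^sub>v v) = \<mu>"
    and min: "\<And>x. x \<in> carrier_vec N \<Longrightarrow> \<mu> * scalar_prod x x \<le> scalar_prod x (Q *\<^sub>v x)"
    using rayleigh_minimizer[OF N Q] by blast
  \<comment> \<open>Half the gradient of that form at v. Moving v by t w produces the linear term 2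
    t <w, w>, which must therefore be zero.\<close>
  define w where "w = Q *\<^sub>v v - \<mu> \<cdot>\<^sub>v v"
  have Qv: "Q *\<^sub>v v \<in> carrier_vec N" and w: "w \<in> carrier_vec N" and Qw: "Q *\<^sub>v w \<in> carrier_vec N"
    using Q v by (auto simp: w_def)
  have ww: "scalar_prod w w = scalar_prod w (Q *\<^sub>v v) - \<mu> * scalar_prod w v"
    using scalar_prod_minus_distrib[OF w Qv smult_carrier_vec[THEN iffD2, OF v(1)], of \<mu>]
      scalar_prod_smult_distrib[OF w v(1), of \<mu>]
    by (simp add: w_def)
  have "0 \<le> 2 * t * scalar_prod w w + t\<^sup>2 * (scalar_prod w (Q *\<^sub>v w) - \<mu> * scalar_prod w w)" for t
  proof -
    let ?x = "v + t \<cdot>\<^sub>v w"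
    have tw: "t \<cdot>\<^sub>v w \<in> carrier_vec N" "t \<cdot>\<^sub>v (Q *\<^sub>v w) \<in> carrier_vec N" using w Qw by auto
    have "scalar_prod ?x ?x = 1 + 2 * t * scalar_prod w v + t\<^sup>2 * scalar_prod w w"
      using v w tw comm_scalar_prod[OF v(1) w]
      by (simp add: add_scalar_prod_distrib[OF v(1) tw(1)] scalar_prod_add_distrib[OF _ v(1) tw(1)]
          algebra_simps power2_eq_square)
    moreover have "Q *\<^sub>v ?x = Q *\<^sub>v v + t \<cdot>\<^sub>v (Q *\<^sub>v w)"
      using Q v w tw by (simp add: mult_add_distrib_mat_vec[OF Q v(1) tw(1)] mult_mat_vec[OF Q w])
    then have "scalar_prod ?x (Q *\<^sub>v ?x) =
      \<mu> + 2 * t * scalar_prod w (Q *\<^sub>v v) + t\<^sup>2 * scalar_prod w (Q *\<^sub>v w)"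
      using v w tw Qv Qw symmetric_scalar_prod[OF Q sym v(1) w]
      by (simp add: add_scalar_prod_distrib[OF v(1) tw(1)] scalar_prod_add_distrib[OF _ Qv tw(2)]
          algebra_simps power2_eq_square)
    ultimately have "\<mu> * (1 + 2 * t * scalar_prod w v + t\<^sup>2 * scalar_prod w w)
      \<le> \<mu> + 2 * t * scalar_prod w (Q *\<^sub>v v) + t\<^sup>2 * scalar_prod w (Q *\<^sub>v w)"
      using min[of ?x] v tw by simp
    moreover have "scalar_prod w (Q *\<^sub>v v) = scalar_prod w w + \<mu> * scalar_prod w v"
      using ww by simp
    ultimately show ?thesis by (simp add: algebra_simps)
  qed
  then have "scalar_prod w w = 0" by (rule linear_term_zero)
  then have "w = 0\<^sub>v N" using scalar_prod_self_eq_0[OF w] by simp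
  have eig: "Q *\<^sub>v v = \<mu> \<cdot>\<^sub>v v"
  proof (rule eq_vecI)
    fix i assume "i < dim_vec (\<mu> \<cdot>\<^sub>v v)"
    moreover have "vec_index w i = 0" if "i < N" using \<open>w = 0\<^sub>v N\<close> that by simp
    ultimately show "vec_index (Q *\<^sub>v v) i = vec_index (\<mu> \<cdot>\<^sub>v v) i"
      using v(1) Qv by (simp add: w_def)
  qed (use v Q in auto)
  have "v \<noteq> 0\<^sub>v N" using v(2) by auto
  with eig v Q have "eigenvalue Q \<mu>" by (auto simp: eigenvalue_def eigenvector_def)
  then show thesis using that min by blast
qed

lemma rayleigh_max_eigenvalue:
  fixes Q :: "real mat"
  assumes N: "0 < N" and Q: "Q \<in> carrier_mat N N" and sym: "transpose_mat Q = Q"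
  obtains \<mu> where "eigenvalue Q \<mu>"
    "\<And>x. x \<in> carrier_vec N \<Longrightarrow> scalar_prod x (Q *\<^sub>v x) \<le> \<mu> * scalar_prod x x"
proof -
  have neg: "- Q *\<^sub>v x = - (Q *\<^sub>v x)" if "x \<in> carrier_vec N" for x
    using Q that by (intro eq_vecI) auto
  have "transpose_mat (- Q) = - Q" using sym Q by (metis transpose_uminus)
  then obtain \<mu> where \<mu>: "eigenvalue (- Q) \<mu>"
    "\<And>x. x \<in> carrier_vec N \<Longrightarrow> \<mu> * scalar_prod x x \<le> scalar_prod x (- Q *\<^sub>v x)"
    using rayleigh_min_eigenvalue[OF N, of "- Q"] Q by auto
  have "eigenvalue Q (- \<mu>)"
  proof -
    obtain v where v: "v \<in> carrier_vec N" "v \<noteq> 0\<^sub>v N" "- Q *\<^sub>v v = \<mu> \<cdot>\<^sub>v v"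
      using \<mu>(1) Q by (auto simp: eigenvalue_def eigenvector_def)
    have "Q *\<^sub>v v = - \<mu> \<cdot>\<^sub>v v"
    proof (rule eq_vecI)
      fix i assume "i < dim_vec (- \<mu> \<cdot>\<^sub>v v)"
      moreover have "vec_index (- (Q *\<^sub>v v)) i = vec_index (\<mu> \<cdot>\<^sub>v v) i" using v neg by simp
      ultimately show "vec_index (Q *\<^sub>v v) i = vec_index (- \<mu> \<cdot>\<^sub>v v) i" using v(1) Q by auto
    qed (use Q v in auto)
    then show ?thesis using v Q by (auto simp: eigenvalue_def eigenvector_def)
  qed
  moreover have "scalar_prod x (Q *\<^sub>v x) \<le> - \<mu> * scalar_prod x x" if x: "x \<in> carrier_vec N" for x
    using \<mu>(2)[OF x] neg[OF x] x Q by simp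
  ultimately show thesis using that by blast
qed

text \<open>Needed for comparing a given eigenvalue with the \<open>Min\<close> or
  \<open>Max\<close> inside \<open>sigma_min\<close> and \<open>sigma_max\<close>; eigenvalues are
  roots of a monic polynomial.\<close>

lemma finite_eigenvalues:
  fixes Q :: "real mat"
  assumes "Q \<in> carrier_mat n n"
  shows "finite {e. eigenvalue Q e}"
proof -
  have "char_poly Q \<noteq> 0" using degree_monic_char_poly[OF assms] by auto
  then show ?thesis using poly_roots_finite eigenvalue_root_char_poly[OF assms] by simp
qed

section \<open>Singular values as bounds on quadratic forms and norms\<close>

lemma scalar_prod_mult_mat_vec:
  fixes M :: "real mat"
  assumes "M \<in> carrier_mat r c" "x \<in> carrier_vec c" "y \<in> carrier_vec r"
  shows "scalar_prod (M *\<^sub>v x) y = scalar_prod x (transpose_mat M *\<^sub>v y)"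
  using transpose_vec_mult_scalar[OF assms]
    comm_scalar_prod[of "M *\<^sub>v x" r y] comm_scalar_prod[of x c "transpose_mat M *\<^sub>v y"] assms
  by simp

text \<open>For symmetric Q the matrix \<open>gram Q\<close> is Q^2, so the square of the least
  Rayleigh quotient \<mu> is one of its eigenvalues and \<open>sigma_min Q\<close> is at most
  |\<mu>|. Semidefiniteness gives \<mu> \<ge> 0 and removes the absolute value.\<close>

lemma sigma_min_quadratic_form:
  fixes Q :: "real mat"
  assumes N: "0 < N" and Q: "Q \<in> carrier_mat N N" and sym: "transpose_mat Q = Q"
    and psd: "\<And>x. x \<in> carrier_vec N \<Longrightarrow> 0 \<le> scalar_prod x (Q *\<^sub>v x)"
    and x: "x \<in> carrier_vec N"
  shows "sigma_min Q * scalar_prod x x \<le> scalar_prod x (Q *\<^sub>v x)"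
proof -
  obtain \<mu> where \<mu>: "eigenvalue Q \<mu>"
    and le: "\<And>x. x \<in> carrier_vec N \<Longrightarrow> \<mu> * scalar_prod x x \<le> scalar_prod x (Q *\<^sub>v x)"
    using rayleigh_min_eigenvalue[OF N Q sym] by blast
  obtain v where v: "v \<in> carrier_vec N" "v \<noteq> 0\<^sub>v N" "Q *\<^sub>v v = \<mu> \<cdot>\<^sub>v v"
    using \<mu> Q by (auto simp: eigenvalue_def eigenvector_def)
  have "scalar_prod v v > 0"
    using scalar_prod_self_nonneg[of v] scalar_prod_self_eq_0[OF v(1)] v(2) by fastforce
  moreover have "0 \<le> \<mu> * scalar_prod v v" using psd[OF v(1)] v by simp
  ultimately have "0 \<le> \<mu>" by (simp add: zero_le_mult_iff)
  have G: "gram Q = Q * Q" "gram Q \<in> carrier_mat N N" using Q sym by (auto simp: gram_def)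
  have "gram Q *\<^sub>v v = \<mu>\<^sup>2 \<cdot>\<^sub>v v"
    using G Q v by (simp add: mult_mat_vec[OF Q v(1)] smult_smult_assoc power2_eq_square)
  then have "eigenvalue (gram Q) (\<mu>\<^sup>2)"
    using v carrier_matD(1)[OF G(2)] unfolding eigenvalue_def eigenvector_def by auto
  then have "Min {e. eigenvalue (gram Q) e} \<le> \<mu>\<^sup>2"
    using finite_eigenvalues[OF G(2)] by (intro Min_le) auto
  then have "sigma_min Q \<le> \<mu>" using \<open>0 \<le> \<mu>\<close> unfolding sigma_min_def by (intro real_le_lsqrt) auto
  then have "sigma_min Q * scalar_prod x x \<le> \<mu> * scalar_prod x x"
    using scalar_prod_self_nonneg by (rule mult_right_mono)
  also note le[OF x]
  finally show ?thesis .
qed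

text \<open>An empty matrix has no eigenvalues, so \<open>sigma_max\<close> is then built from an unspecified
  \<open>Max {}\<close>; its square is nonnegative all the same, and the left-hand side vanishes.\<close>

lemma sigma_max_bound:
  fixes M :: "real mat"
  assumes M: "M \<in> carrier_mat r c" and x: "x \<in> carrier_vec c"
  shows "scalar_prod (M *\<^sub>v x) (M *\<^sub>v x) \<le> (sigma_max M)\<^sup>2 * scalar_prod x x"
proof (cases "r = 0 \<or> c = 0")
  case True
  then have "scalar_prod (M *\<^sub>v x) (M *\<^sub>v x) = 0" using M x by (auto simp: scalar_prod_def)
  then show ?thesis using scalar_prod_self_nonneg[of x] by simp
next
  case False
  define k where "k = min r c"
  have G: "gram M \<in> carrier_mat k k" "transpose_mat (gram M) = gram M" "0 < k"
    using M False transpose_mult[OF M, of "transpose_mat M" r] transpose_mult[of "transpose_mat M" c r M c]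
    by (auto simp: gram_def k_def)
  obtain \<mu> where \<mu>: "eigenvalue (gram M) \<mu>"
    and le: "\<And>y. y \<in> carrier_vec k \<Longrightarrow> scalar_prod y (gram M *\<^sub>v y) \<le> \<mu> * scalar_prod y y"
    using rayleigh_max_eigenvalue[OF G(3,1,2)] by blast
  have mono: "\<mu> \<le> (sigma_max M)\<^sup>2"
  proof -
    have "\<mu> \<le> Max {e. eigenvalue (gram M) e}"
      using finite_eigenvalues[OF G(1)] \<mu> by (intro Max_ge) auto
    also have "\<dots> \<le> (sigma_max M)\<^sup>2"
    proof -
      \<comment> \<open>A negative y lies below any square, so the sign of the maximal eigenvalue
        need not be known here.\<close>
      have "y \<le> (sqrt y)\<^sup>2" for y :: real
        by (cases "0 \<le> y") (auto intro: order.trans[OF _ zero_le_power2])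
      then show ?thesis by (simp add: sigma_max_def)
    qed
    finally show ?thesis .
  qed
  have "scalar_prod (M *\<^sub>v x) (M *\<^sub>v x) \<le> \<mu> * scalar_prod x x"
  proof (cases "c \<le> r")
    case True
    then have "scalar_prod (M *\<^sub>v x) (M *\<^sub>v x) = scalar_prod x (gram M *\<^sub>v x)"
      using M x by (simp add: gram_def scalar_prod_mult_mat_vec[OF M])
    also have "\<dots> \<le> \<mu> * scalar_prod x x" using le[of x] x True by (simp add: k_def)
    finally show ?thesis .
  next
    case False
    \<comment> \<open>With fewer rows than columns, \<open>gram M\<close> is M M^T and bounds M^T y
      instead of M x. The identity <y, y> = <x, M^T y> links the two.\<close>
    define y where "y = M *\<^sub>v x"
    define w where "w = transpose_mat M *\<^sub>v y"
    have y: "y \<in> carrier_vec r" and w: "w \<in> carrier_vec c" using M x by (auto simp: y_def w_def)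
    have yy: "scalar_prod y y = scalar_prod x w"
      using scalar_prod_mult_mat_vec[OF M x y] by (simp add: y_def w_def)
    have "scalar_prod w w = scalar_prod y (gram M *\<^sub>v y)"
      using scalar_prod_mult_mat_vec[of "transpose_mat M" c r y w] M y w False
      by (simp add: gram_def w_def)
    also have "\<dots> \<le> \<mu> * scalar_prod y y" using le[of y] y False by (simp add: k_def)
    finally have ww: "scalar_prod w w \<le> \<mu> * scalar_prod y y" .
    have ms: "\<mu> \<cdot>\<^sub>v x \<in> carrier_vec c" using x by simp
    \<comment> \<open>Expanding this square and inserting \<open>yy\<close> and \<open>ww\<close>
      leaves \<mu> <y, y> \<le> \<mu>^2 <x, x>, from which a factor \<mu> > 0 may be
      cancelled.\<close>
    have "0 \<le> scalar_prod (\<mu> \<cdot>\<^sub>v x - w) (\<mu> \<cdot>\<^sub>v x - w)" by (rule scalar_prod_self_nonneg)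
    also have "\<dots> = \<mu> * (\<mu> * scalar_prod x x) - 2 * \<mu> * scalar_prod y y + scalar_prod w w"
      using x w ms comm_scalar_prod[OF x w] yy
      by (simp add: minus_scalar_prod_distrib[OF ms w] scalar_prod_minus_distrib[OF _ ms w] algebra_simps)
    finally have *: "\<mu> * scalar_prod y y \<le> \<mu> * (\<mu> * scalar_prod x x)" using ww by linarith
    show ?thesis
    proof (cases "scalar_prod y y = 0")
      case True
      \<comment> \<open>For y = 0 the bound \<open>ww\<close> does not reveal the sign of \<mu>; it
        comes from an eigenvector v of M M^T, where \<mu> <v, v> = |M^T v|^2.\<close>
      have "0 \<le> \<mu>"
      proof -
        obtain v where v: "v \<in> carrier_vec k" "v \<noteq> 0\<^sub>v k" "gram M *\<^sub>v v = \<mu> \<cdot>\<^sub>v v"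
          using \<mu> G by (auto simp: eigenvalue_def eigenvector_def)
        have "scalar_prod v v > 0"
          using scalar_prod_self_nonneg[of v] scalar_prod_self_eq_0[OF v(1)] v(2) by fastforce
        moreover have "\<mu> * scalar_prod v v = scalar_prod (transpose_mat M *\<^sub>v v) (transpose_mat M *\<^sub>v v)"
          using v False M scalar_prod_mult_mat_vec[of "transpose_mat M" c r v "transpose_mat M *\<^sub>v v"]
          by (simp add: k_def gram_def)
        ultimately show ?thesis
          by (metis scalar_prod_self_nonneg zero_le_mult_iff not_less)
      qed
      then show ?thesis using True scalar_prod_self_nonneg[of x] by (simp add: y_def)
    next
      case False
      then have yp: "0 < scalar_prod y y" using scalar_prod_self_nonneg[of y] by simp
      have "\<mu> \<noteq> 0"
      proof
        assume "\<mu> = 0"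
        then have "w = 0\<^sub>v c" using ww scalar_prod_self_nonneg[of w] scalar_prod_self_eq_0[OF w] by simp
        then show False using yy x False by simp
      qed
      moreover have "0 \<le> \<mu>" using ww scalar_prod_self_nonneg[of w] yp
        by (metis order.trans zero_le_mult_iff not_less)
      ultimately show ?thesis using * by (simp add: y_def)
    qed
  qed
  also have "\<dots> \<le> (sigma_max M)\<^sup>2 * scalar_prod x x"
    using mono scalar_prod_self_nonneg by (rule mult_right_mono)
  finally show ?thesis .
qed

section \<open>The pseudoinverse of an injective matrix\<close>

lemma inverse_symmetric:
  fixes G H :: "real mat"
  assumes G: "G \<in> carrier_mat c c" and H: "H \<in> carrier_mat c c"
    and Gsym: "transpose_mat G = G" and inv: "H * G = 1\<^sub>m c" "G * H = 1\<^sub>m c"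
  shows "transpose_mat H = H"
proof -
  have HT: "transpose_mat H \<in> carrier_mat c c" using H by simp
  have "transpose_mat H * G = 1\<^sub>m c"
    using transpose_mult[OF G H] inv Gsym by simp
  then have "transpose_mat H = transpose_mat H * (G * H)" "transpose_mat H * (G * H) = H"
    using H HT inv assoc_mult_mat[OF HT G H] by auto
  then show ?thesis by simp
qed

text \<open>An injective M has an invertible Gram matrix, since M^T M v = 0 forces |M v|^2 = 0. The
  candidate (M^T M)^-1 M^T satisfies the Penrose equations, and it remains to see that nothing else
  does.\<close>

lemma pinv_left_inverse:
  fixes M :: "real mat"
  assumes M: "M \<in> carrier_mat r c"
    and inj: "\<And>v. v \<in> carrier_vec c \<Longrightarrow> M *\<^sub>v v = 0\<^sub>v r \<Longrightarrow> v = 0\<^sub>v c"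
  shows "pinv M \<in> carrier_mat c r" "pinv M * M = 1\<^sub>m c"
proof -
  let ?G = "transpose_mat M * M"
  have MT: "transpose_mat M \<in> carrier_mat c r" and G: "?G \<in> carrier_mat c c" using M by auto
  have Gsym: "transpose_mat ?G = ?G" using transpose_mult[OF MT M] by simp
  have "Determinant.det ?G \<noteq> 0"
  proof
    assume "Determinant.det ?G = 0"
    then obtain v where v: "v \<in> carrier_vec c" "v \<noteq> 0\<^sub>v c" "?G *\<^sub>v v = 0\<^sub>v c"
      using det_0_iff_vec_prod_zero_field[OF G] by blast
    have "scalar_prod (M *\<^sub>v v) (M *\<^sub>v v) = scalar_prod v (?G *\<^sub>v v)"
      using M MT v by (simp add: scalar_prod_mult_mat_vec[OF M])
    also have "\<dots> = 0" using v by simp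
    finally have "M *\<^sub>v v = 0\<^sub>v r" using M v by (intro scalar_prod_self_eq_0) auto
    then show False using inj v by blast
  qed
  from det_non_zero_imp_unit[OF G this, of "()"]
  obtain H where H: "H \<in> carrier_mat c c" "H * ?G = 1\<^sub>m c" "?G * H = 1\<^sub>m c"
    unfolding Units_def ring_mat_def by auto
  have Hsym: "transpose_mat H = H" by (rule inverse_symmetric[OF G H(1) Gsym H(2,3)])
  define P where "P = H * transpose_mat M"
  have P: "P \<in> carrier_mat c r" using H MT by (simp add: P_def)
  have PM: "P * M = 1\<^sub>m c" using H MT M by (simp add: P_def assoc_mult_mat[OF H(1) MT M])
  have left: "X = Y" if X: "X \<in> carrier_mat c q" and Y: "Y \<in> carrier_mat c q" and "M * X = M * Y" for X Y q
  proof -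
    have "P * M * X = P * M * Y" using assoc_mult_mat[OF P M X] assoc_mult_mat[OF P M Y] that by simp
    then show ?thesis using PM X Y by simp
  qed
  let ?MP = "\<lambda>G. G \<in> carrier_mat c r \<and> M * G * M = M \<and> G * M * G = G \<and>
     transpose_mat (M * G) = M * G \<and> transpose_mat (G * M) = G * M"
  have MPP: "?MP P"
  proof (intro conjI P)
    show "M * P * M = M" using assoc_mult_mat[OF M P M] PM M by simp
    show "P * M * P = P" using PM P by simp
    have "M * P = M * H * transpose_mat M" using M H MT by (simp add: P_def)
    then show "transpose_mat (M * P) = M * P"
      using transpose_mult[of "M * H" r c "transpose_mat M" r] transpose_mult[OF M H(1)] M H MT Hsym
        assoc_mult_mat[OF M H(1) MT] by simp
    show "transpose_mat (P * M) = P * M" using PM by simp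
  qed
  \<comment> \<open>M E and M P are symmetric projections with the range of M, so M E = (M P)(M E) =
    ((M E)(M P))^T = M P, and the left inverse cancels M.\<close>
  have uniq: "E = P" if E: "?MP E" for E
  proof -
    have c: "M * E \<in> carrier_mat r r" "M * P \<in> carrier_mat r r" using M E P by auto
    have "M * E = M * P * M * E" using MPP by simp
    also have "\<dots> = (M * P) * (M * E)"
      using assoc_mult_mat[of "M * P" r r M c E r] c M E by simp
    also have "\<dots> = transpose_mat (transpose_mat ((M * P) * (M * E)))" by simp
    also have "\<dots> = transpose_mat ((M * E) * (M * P))"
      using transpose_mult[OF c(2,1)] E MPP by simp
    also have "(M * E) * (M * P) = M * E * M * P"
      using assoc_mult_mat[of "M * E" r r M c P r] c M P by simp
    also have "transpose_mat (M * E * M * P) = M * P" using E MPP by simp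
    finally show ?thesis using left[of E r P] E P by simp
  qed
  have "pinv M = (THE G. ?MP G)" using M by (simp add: pinv_def)
  also have "\<dots> = P" by (rule the_equality[of ?MP, OF MPP uniq])
  finally show "pinv M \<in> carrier_mat c r" "pinv M * M = 1\<^sub>m c" using P PM by auto
qed

section \<open>The Frobenius inner product, treated column by column, and least squares\<close>

lemma frob_inner_col:
  assumes "X \<in> carrier_mat n l" "Y \<in> carrier_mat n l"
  shows "frob_inner X Y = (\<Sum>j<l. scalar_prod (col X j) (col Y j))"
proof -
  have "frob_inner X Y = (\<Sum>j<l. \<Sum>i<n. X $$ (i, j) * Y $$ (i, j))"
    using assms unfolding frob_inner_def by (subst sum.swap) simp
  also have "\<dots> = (\<Sum>j<l. scalar_prod (col X j) (col Y j))"
    using assms by (intro sum.cong) (auto simp: scalar_prod_def lessThan_atLeast0)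
  finally show ?thesis .
qed

lemma frob_inner_commute:
  assumes "X \<in> carrier_mat n l" "Y \<in> carrier_mat n l"
  shows "frob_inner X Y = frob_inner Y X"
  using assms by (simp add: frob_inner_def mult.commute)

lemma frob_inner_diff_left:
  assumes "X \<in> carrier_mat n l" "Y \<in> carrier_mat n l" "Z \<in> carrier_mat n l"
  shows "frob_inner (X - Y) Z = frob_inner X Z - frob_inner Y Z"
  using assms by (simp add: frob_inner_def algebra_simps sum_subtractf)

lemma frob_inner_smult_left:
  assumes "X \<in> carrier_mat n l" "Z \<in> carrier_mat n l"
  shows "frob_inner (t \<cdot>\<^sub>m X) Z = t * frob_inner X Z"
  using assms by (simp add: frob_inner_def algebra_simps sum_distrib_left)

lemma frob_inner_self_nonneg: "0 \<le> frob_inner X X"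
  by (auto simp: frob_inner_def intro!: sum_nonneg)

lemma frob_inner_self_eq_0:
  assumes "X \<in> carrier_mat n l" "frob_inner X X = 0"
  shows "X = 0\<^sub>m n l"
proof (rule eq_matI)
  fix i j assume "i < dim_row (0\<^sub>m n l :: real mat)" "j < dim_col (0\<^sub>m n l :: real mat)"
  then have ij: "i < n" "j < l" by auto
  have "(\<Sum>j<l. X $$ (i, j) * X $$ (i, j)) = 0"
    using assms ij by (auto simp: frob_inner_def sum_nonneg_eq_0_iff sum_nonneg)
  then show "X $$ (i, j) = 0\<^sub>m n l $$ (i, j)"
    using ij by (auto simp: sum_nonneg_eq_0_iff)
qed (use assms in auto)

lemma frob_inner_mult_left:
  assumes "M \<in> carrier_mat r c" "X \<in> carrier_mat c l" "Y \<in> carrier_mat r l"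
  shows "frob_inner (M * X) Y = frob_inner X (transpose_mat M * Y)"
proof -
  have MT: "transpose_mat M \<in> carrier_mat c r" using assms by simp
  have "frob_inner (M * X) Y = (\<Sum>j<l. scalar_prod (M *\<^sub>v col X j) (col Y j))"
    using assms frob_inner_col[of "M * X" r l Y] by (simp add: col_mult2[OF assms(1,2)] del: col_mult)
  also have "\<dots> = (\<Sum>j<l. scalar_prod (col X j) (transpose_mat M *\<^sub>v col Y j))"
    using assms by (intro sum.cong scalar_prod_mult_mat_vec) auto
  also have "\<dots> = frob_inner X (transpose_mat M * Y)"
    using assms MT frob_inner_col[of X c l "transpose_mat M * Y"]
    by (simp add: col_mult2[OF MT assms(3)] del: col_mult)
  finally show ?thesis .
qed

lemma frob_inner_sigma_min:
  fixes Q :: "real mat"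
  assumes N: "0 < N" and Q: "Q \<in> carrier_mat N N" and sym: "transpose_mat Q = Q"
    and psd: "\<And>x. x \<in> carrier_vec N \<Longrightarrow> 0 \<le> scalar_prod x (Q *\<^sub>v x)"
    and X: "X \<in> carrier_mat N l"
  shows "sigma_min Q * frob_inner X X \<le> frob_inner X (Q * X)"
proof -
  have "sigma_min Q * frob_inner X X = (\<Sum>j<l. sigma_min Q * scalar_prod (col X j) (col X j))"
    by (simp add: frob_inner_col[OF X X] sum_distrib_left)
  also have "\<dots> \<le> (\<Sum>j<l. scalar_prod (col X j) (Q *\<^sub>v col X j))"
    using X by (intro sum_mono sigma_min_quadratic_form[OF N Q sym psd]) auto
  also have "\<dots> = frob_inner X (Q * X)"
    using X Q frob_inner_col[of X N l "Q * X"] by (simp add: col_mult2[OF Q X] del: col_mult)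
  finally show ?thesis .
qed

lemma frob_inner_sigma_max:
  assumes M: "M \<in> carrier_mat r c" and X: "X \<in> carrier_mat c l"
  shows "frob_inner (M * X) (M * X) \<le> (sigma_max M)\<^sup>2 * frob_inner X X"
proof -
  have "frob_inner (M * X) (M * X) = (\<Sum>j<l. scalar_prod (M *\<^sub>v col X j) (M *\<^sub>v col X j))"
    using X M frob_inner_col[of "M * X" r l "M * X"] by (simp add: col_mult2[OF M X] del: col_mult)
  also have "\<dots> \<le> (\<Sum>j<l. (sigma_max M)\<^sup>2 * scalar_prod (col X j) (col X j))"
    using X by (intro sum_mono sigma_max_bound[OF M]) auto
  also have "\<dots> = (sigma_max M)\<^sup>2 * frob_inner X X"
    by (simp add: frob_inner_col[OF X X] sum_distrib_left)
  finally show ?thesis .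
qed

lemma frob_inner_diff_self:
  assumes X: "X \<in> carrier_mat n l" and Y: "Y \<in> carrier_mat n l"
  shows "frob_inner (X - Y) (X - Y) = frob_inner X X - 2 * frob_inner X Y + frob_inner Y Y"
proof -
  have XY: "X - Y \<in> carrier_mat n l" using X Y by auto
  have "frob_inner (X - Y) (X - Y) = frob_inner X (X - Y) - frob_inner Y (X - Y)"
    by (rule frob_inner_diff_left[OF X Y XY])
  also have "\<dots> = frob_inner (X - Y) X - frob_inner (X - Y) Y"
    using frob_inner_commute[OF X XY] frob_inner_commute[OF Y XY] by simp
  also have "\<dots> = frob_inner X X - 2 * frob_inner X Y + frob_inner Y Y"
    using frob_inner_commute[OF X Y] by (simp add: frob_inner_diff_left[OF X Y X] frob_inner_diff_left[OF X Y Y])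
  finally show ?thesis .
qed

text \<open>W = M^T (M U - b) is half the gradient of the objective at U. Replacing U by U - t W
  changes the objective by - 2 t |W|^2 + t^2 |M W|^2, which minimality keeps nonnegative for every
  t.\<close>

lemma least_squares_normal_equation:
  assumes M: "M \<in> carrier_mat r c" and U: "U \<in> carrier_mat c l" and b: "b \<in> carrier_mat r l"
    and min: "\<And>V. V \<in> carrier_mat c l \<Longrightarrow>
      frob_inner (M * U - b) (M * U - b) \<le> frob_inner (M * V - b) (M * V - b)"
  shows "transpose_mat M * (M * U - b) = 0\<^sub>m c l"
proof -
  define z where "z = M * U - b"
  define W where "W = transpose_mat M * z"
  have z: "z \<in> carrier_mat r l" using M U b by (auto simp: z_def)
  have W: "W \<in> carrier_mat c l" using M z by (auto simp: W_def)
  have MW: "M * W \<in> carrier_mat r l" using M W by auto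
  have zMW: "frob_inner z (M * W) = frob_inner W W"
    using frob_inner_mult_left[OF M W z] frob_inner_commute[OF z MW] by (simp add: W_def)
  have "0 \<le> 2 * t * (- frob_inner W W) + t\<^sup>2 * frob_inner (M * W) (M * W)" for t
  proof -
    have tMW: "t \<cdot>\<^sub>m (M * W) \<in> carrier_mat r l" and tW: "t \<cdot>\<^sub>m W \<in> carrier_mat c l" using MW W by auto
    have "M * (U - t \<cdot>\<^sub>m W) - b = z - t \<cdot>\<^sub>m (M * W)"
      using M U b W MW tMW
      by (intro eq_matI) (auto simp: z_def mult_minus_distrib_mat[OF M U tW] mult_smult_distrib[OF M W])
    then have "frob_inner z z \<le> frob_inner (z - t \<cdot>\<^sub>m (M * W)) (z - t \<cdot>\<^sub>m (M * W))"
      using min[of "U - t \<cdot>\<^sub>m W"] U tW by (simp add: z_def minus_carrier_mat)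
    also have "\<dots> = frob_inner z z - 2 * t * frob_inner W W + t\<^sup>2 * frob_inner (M * W) (M * W)"
      using zMW frob_inner_commute[OF z tMW] frob_inner_commute[OF z MW] frob_inner_commute[OF MW tMW]
      by (simp add: frob_inner_diff_self[OF z tMW] frob_inner_smult_left[OF MW z]
          frob_inner_smult_left[OF MW tMW] frob_inner_smult_left[OF MW MW] power2_eq_square)
    finally show ?thesis by simp
  qed
  then have "- frob_inner W W = 0" by (rule linear_term_zero)
  then show ?thesis using frob_inner_self_eq_0[OF W] by (simp add: W_def z_def)
qed

text \<open>The first equation yields 0 \<le> <R, P R>, the second <R, P R> \<le> <R, R>. Unlike
  idempotence, both bounds survive averaging over P.\<close>

lemma frob_inner_proj:
  assumes P: "P \<in> carrier_mat N N" "transpose_mat P = P" "P * P = P" and R: "R \<in> carrier_mat N l"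
  shows "frob_inner R (P * R) = frob_inner (P * R) (P * R)"
    "frob_inner (R - P * R) (R - P * R) = frob_inner R R - frob_inner R (P * R)"
proof -
  have PR: "P * R \<in> carrier_mat N l" using P R by auto
  show *: "frob_inner R (P * R) = frob_inner (P * R) (P * R)"
    using frob_inner_mult_left[OF P(1) R PR] P assoc_mult_mat[OF P(1) P(1) R] by simp
  show "frob_inner (R - P * R) (R - P * R) = frob_inner R R - frob_inner R (P * R)"
    using frob_inner_diff_self[OF R PR] * by simp
qed

subsection \<open>The block step and its expected error\<close>

lemma mat_diff_split:
  fixes X Y Z :: "real mat"
  assumes "X \<in> carrier_mat n l" "Y \<in> carrier_mat n l" "Z \<in> carrier_mat n l"
  shows "X - Z = (X - Y) + (Y - Z)"
  using assms by (intro eq_matI) auto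

lemma mat_diff_diff_commute:
  fixes X Y Z :: "real mat"
  assumes "X \<in> carrier_mat n l" "Y \<in> carrier_mat n l" "Z \<in> carrier_mat n l"
  shows "X - Y - Z = X - Z - Y"
  using assms by (intro eq_matI) auto

text \<open>Puts the columns of a block into the range of \<open>bcirc A\<close>. Read transposed,
  it lets the normal equations act on each block; read forwards, it simplifies the update.\<close>

lemma bcirc_sub_cols:
  assumes "0 < p" "is_tensor A m n p" "\<tau> \<subseteq> {0..<n}"
  shows "bcirc (sub_cols A \<tau>) = bcirc A * bcirc (E_tau n \<tau> p)"
  using bcirc_tprod[OF assms(1,2) E_tau_tensor] tprod_E_tau[OF assms] by metis

text \<open>The matrix picture of one block: G is (N^T N)^-1, and the later computations with the
  projection and the step run entirely on N and G.\<close>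

lemma sub_cols_gram:
  assumes p: "0 < p" and A: "is_tensor A m n p"
    and inv: "tinvertible (ttrans (sub_cols A \<tau>) \<star> sub_cols A \<tau>)"
  defines "N \<equiv> bcirc (sub_cols A \<tau>)"
    and "G \<equiv> bcirc (tinv (ttrans (sub_cols A \<tau>) \<star> sub_cols A \<tau>))"
  shows "N \<in> carrier_mat (m * p) (card \<tau> * p)" "G \<in> carrier_mat (card \<tau> * p) (card \<tau> * p)"
    "is_tensor (tinv (ttrans (sub_cols A \<tau>) \<star> sub_cols A \<tau>)) (card \<tau>) (card \<tau>) p"
    "transpose_mat G = G" "G * (transpose_mat N * N) = 1\<^sub>m (card \<tau> * p)"
proof -
  let ?S = "sub_cols A \<tau>"
  let ?C = "ttrans ?S \<star> ?S"
  note S = sub_cols_tensor[OF A, of \<tau>]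
  note ST = ttrans_tensor[OF S]
  note C = tprod_tensor[OF p ST S]
  note ti = tinv_props[OF p C inv]
  show N: "N \<in> carrier_mat (m * p) (card \<tau> * p)" unfolding N_def by (rule bcirc_carrier[OF p S])
  show G: "G \<in> carrier_mat (card \<tau> * p) (card \<tau> * p)" unfolding G_def by (rule bcirc_carrier[OF p ti(1)])
  show "is_tensor (tinv ?C) (card \<tau>) (card \<tau>) p" by (rule ti(1))
  have C_eq: "bcirc ?C = transpose_mat N * N"
    by (simp add: N_def bcirc_tprod[OF p ST S] bcirc_ttrans[OF p S])
  show GC: "G * (transpose_mat N * N) = 1\<^sub>m (card \<tau> * p)" using ti(2) by (simp add: G_def C_eq)
  have NT: "transpose_mat N \<in> carrier_mat (card \<tau> * p) (m * p)" using N by simp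
  show "transpose_mat G = G"
  proof (rule inverse_symmetric[OF _ G _ GC])
    show "transpose_mat N * N \<in> carrier_mat (card \<tau> * p) (card \<tau> * p)" using N by auto
    show "transpose_mat (transpose_mat N * N) = transpose_mat N * N"
      using transpose_mult[OF NT N] by simp
    show "transpose_mat N * N * G = 1\<^sub>m (card \<tau> * p)" using ti(3) by (simp add: G_def C_eq)
  qed
qed

lemma bcirc_proj_t:
  assumes p: "0 < p" and A: "is_tensor A m n p"
    and inv: "tinvertible (ttrans (sub_cols A \<tau>) \<star> sub_cols A \<tau>)"
  shows "bcirc (proj_t A \<tau>) = bcirc (sub_cols A \<tau>) *
    (bcirc (tinv (ttrans (sub_cols A \<tau>) \<star> sub_cols A \<tau>)) * transpose_mat (bcirc (sub_cols A \<tau>)))"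
proof -
  note S = sub_cols_tensor[OF A, of \<tau>]
  note ST = ttrans_tensor[OF S]
  note g = sub_cols_gram[OF p A inv]
  show ?thesis
    by (simp add: proj_t_def Let_def bcirc_tprod[OF p S tprod_tensor[OF p g(3) ST]]
        bcirc_tprod[OF p g(3) ST] bcirc_ttrans[OF p S])
qed

text \<open>P = N (N^T N)^-1 N^T is the classical orthogonal projection onto the column space of N.
  Symmetry comes from G, and in P P the inner factor G N^T N collapses to the identity.\<close>

lemma bcirc_proj_t_projection:
  assumes p: "0 < p" and A: "is_tensor A m n p"
    and inv: "tinvertible (ttrans (sub_cols A \<tau>) \<star> sub_cols A \<tau>)"
  defines "P \<equiv> bcirc (proj_t A \<tau>)"
  shows "P \<in> carrier_mat (m * p) (m * p)" "transpose_mat P = P" "P * P = P"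
proof -
  define c N G where "c = card \<tau> * p" and "N = bcirc (sub_cols A \<tau>)"
    and "G = bcirc (tinv (ttrans (sub_cols A \<tau>) \<star> sub_cols A \<tau>))"
  note g = sub_cols_gram[OF p A inv, folded c_def N_def G_def]
  have NT: "transpose_mat N \<in> carrier_mat c (m * p)" using g by simp
  have GN: "G * transpose_mat N \<in> carrier_mat c (m * p)" using g NT by auto
  have P: "P = N * (G * transpose_mat N)"
    using bcirc_proj_t[OF p A inv] by (simp add: P_def N_def G_def)
  show "P \<in> carrier_mat (m * p) (m * p)" using g GN by (auto simp: P)
  have "transpose_mat P = transpose_mat (G * transpose_mat N) * transpose_mat N"
    using transpose_mult[OF g(1) GN] by (simp add: P)
  also have "\<dots> = N * G * transpose_mat N" using transpose_mult[OF g(2) NT] g(4) by simp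
  also have "\<dots> = P" using assoc_mult_mat[OF g(1,2) NT] by (simp add: P)
  finally show "transpose_mat P = P" .
  have "P * P = N * ((G * transpose_mat N) * (N * (G * transpose_mat N)))"
    unfolding P using g GN by (intro assoc_mult_mat) auto
  also have "(G * transpose_mat N) * (N * (G * transpose_mat N)) = (G * transpose_mat N * N) * (G * transpose_mat N)"
    using assoc_mult_mat[OF GN g(1) GN] by simp
  also have "G * transpose_mat N * N = 1\<^sub>m c" using assoc_mult_mat[OF g(2) NT g(1)] g(5) by simp
  finally show "P * P = P" by (simp add: P left_mult_one_mat[OF GN])
qed

text \<open>N = M J gives N^T z = J^T (M^T z) = 0, and P ends in the factor N^T.\<close>

lemma bcirc_proj_t_annihilates:
  assumes p: "0 < p" and A: "is_tensor A m n p" and \<tau>: "\<tau> \<subseteq> {0..<n}"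
    and inv: "tinvertible (ttrans (sub_cols A \<tau>) \<star> sub_cols A \<tau>)"
    and z: "z \<in> carrier_mat (m * p) l" "transpose_mat (bcirc A) * z = 0\<^sub>m (n * p) l"
  shows "bcirc (proj_t A \<tau>) * z = 0\<^sub>m (m * p) l"
proof -
  define c N G J where "c = card \<tau> * p" and "N = bcirc (sub_cols A \<tau>)"
    and "G = bcirc (tinv (ttrans (sub_cols A \<tau>) \<star> sub_cols A \<tau>))" and "J = bcirc (E_tau n \<tau> p)"
  note g = sub_cols_gram[OF p A inv, folded c_def N_def G_def]
  have M: "bcirc A \<in> carrier_mat (m * p) (n * p)" by (rule bcirc_carrier[OF p A])
  have J: "J \<in> carrier_mat (n * p) c" unfolding J_def c_def by (rule bcirc_carrier[OF p E_tau_tensor])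
  have NT: "transpose_mat N \<in> carrier_mat c (m * p)" using g by simp
  have GN: "G * transpose_mat N \<in> carrier_mat c (m * p)" using g NT by auto
  have "transpose_mat N * z = transpose_mat J * transpose_mat (bcirc A) * z"
    using bcirc_sub_cols[OF p A \<tau>] transpose_mult[OF M J] by (simp add: N_def J_def)
  also have "\<dots> = transpose_mat J * (transpose_mat (bcirc A) * z)"
    using M J z(1) by (intro assoc_mult_mat) auto
  also have "\<dots> = 0\<^sub>m c l" using z(2) J by simp
  finally have Nz: "transpose_mat N * z = 0\<^sub>m c l" .
  have "bcirc (proj_t A \<tau>) * z = N * (G * (transpose_mat N * z))"
    using bcirc_proj_t[OF p A inv] assoc_mult_mat[OF g(1) GN z(1)] assoc_mult_mat[OF g(2) NT z(1)]
    by (simp add: N_def G_def)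
  then show ?thesis using Nz g by simp
qed

section \<open>The block step and its effect on the residual\<close>

lemma trbgs_step_tensor:
  assumes p: "0 < p" and A: "is_tensor A m n p" and B: "is_tensor B m l p"
    and inv: "tinvertible (ttrans (sub_cols A \<tau>) \<star> sub_cols A \<tau>)"
    and X: "is_tensor X n l p"
  shows "is_tensor (trbgs_step A B X \<tau>) n l p"
proof -
  note t2 = tprod_tensor[OF p ttrans_tensor[OF sub_cols_tensor[OF A]]
      tsub_tensor[OF tprod_tensor[OF p A X] B]]
  have dims: "dim_col (A ! 0) = n" "length A = p"
    using is_tensorD(1)[OF A] is_tensorD(2)[OF A p] by auto
  show ?thesis
    unfolding trbgs_step_def Let_def dims
    by (rule tsub_tensor[OF X tprod_tensor[OF p E_tau_tensor
          tprod_tensor[OF p sub_cols_gram(3)[OF p A inv] t2]]])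
qed

text \<open>Multiplication by M turns the leading factor J of the update into M J = N, and N G N^T
  is the projection.\<close>

lemma trbgs_step_residual:
  assumes p: "0 < p" and A: "is_tensor A m n p" and B: "is_tensor B m l p"
    and \<tau>: "\<tau> \<subseteq> {0..<n}"
    and inv: "tinvertible (ttrans (sub_cols A \<tau>) \<star> sub_cols A \<tau>)"
    and X: "is_tensor X n l p"
  shows "bcirc A * unfold_t (trbgs_step A B X \<tau>) = bcirc A * unfold_t X
    - bcirc (proj_t A \<tau>) * (bcirc A * unfold_t X - unfold_t B)"
proof -
  define c N G J where "c = card \<tau> * p" and "N = bcirc (sub_cols A \<tau>)"
    and "G = bcirc (tinv (ttrans (sub_cols A \<tau>) \<star> sub_cols A \<tau>))" and "J = bcirc (E_tau n \<tau> p)"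
  define D where "D = bcirc A * unfold_t X - unfold_t B"
  note g = sub_cols_gram[OF p A inv, folded c_def N_def G_def]
  note S = sub_cols_tensor[OF A, of \<tau>]
  note ST = ttrans_tensor[OF S]
  note E = E_tau_tensor[of n \<tau> p]
  note AX = tprod_tensor[OF p A X]
  note t1 = tsub_tensor[OF AX B]
  note t2 = tprod_tensor[OF p ST t1]
  note t3 = tprod_tensor[OF p sub_cols_gram(3)[OF p A inv] t2]
  note t4 = tprod_tensor[OF p E t3]
  have dims: "dim_col (A ! 0) = n" "length A = p"
    using is_tensorD(1)[OF A] is_tensorD(2)[OF A p] by auto
  have M: "bcirc A \<in> carrier_mat (m * p) (n * p)" by (rule bcirc_carrier[OF p A])
  have J: "J \<in> carrier_mat (n * p) c" unfolding J_def c_def by (rule bcirc_carrier[OF p E_tau_tensor])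
  have U: "unfold_t X \<in> carrier_mat (n * p) l" by (rule unfold_carrier[OF p X])
  have D: "D \<in> carrier_mat (m * p) l"
    unfolding D_def by (intro minus_carrier_mat unfold_carrier[OF p B])
  have NT: "transpose_mat N \<in> carrier_mat c (m * p)" using g by simp
  have ND: "transpose_mat N * D \<in> carrier_mat c l" using NT D by auto
  have GND: "G * (transpose_mat N * D) \<in> carrier_mat c l" using g ND by auto
  have GN: "G * transpose_mat N \<in> carrier_mat c (m * p)" using g NT by auto
  have "unfold_t (trbgs_step A B X \<tau>) = unfold_t X - J * (G * (transpose_mat N * D))"
    by (simp add: trbgs_step_def Let_def dims unfold_tsub[OF p X t4] unfold_tprod[OF p E t3]
        unfold_tprod[OF p sub_cols_gram(3)[OF p A inv] t2] unfold_tprod[OF p ST t1]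
        unfold_tsub[OF p AX B] unfold_tprod[OF p A X] bcirc_ttrans[OF p S] N_def G_def J_def D_def)
  then have "bcirc A * unfold_t (trbgs_step A B X \<tau>)
      = bcirc A * unfold_t X - bcirc A * (J * (G * (transpose_mat N * D)))"
    using mult_minus_distrib_mat[OF M U mult_carrier_mat[OF J GND]] by simp
  also have "bcirc A * (J * (G * (transpose_mat N * D))) = N * (G * (transpose_mat N * D))"
    using assoc_mult_mat[OF M J GND] bcirc_sub_cols[OF p A \<tau>] by (simp add: N_def J_def)
  also have "\<dots> = bcirc (proj_t A \<tau>) * D"
    using bcirc_proj_t[OF p A inv] assoc_mult_mat[OF g(1) GN D] assoc_mult_mat[OF g(2) NT D]
    by (simp add: N_def G_def)
  finally show ?thesis by (simp add: D_def)
qed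

section \<open>Averaging over the random block\<close>

lemma expectation_frob_inner:
  fixes D :: "'a pmf" and P :: "'a \<Rightarrow> real mat"
  assumes fin: "finite (set_pmf D)"
    and P: "\<And>\<tau>. \<tau> \<in> set_pmf D \<Longrightarrow> P \<tau> \<in> carrier_mat N N"
    and R: "R \<in> carrier_mat N l"
  shows "measure_pmf.expectation D (\<lambda>\<tau>. frob_inner R (P \<tau> * R)) =
    frob_inner R (Matrix.mat N N (\<lambda>ij. measure_pmf.expectation D (\<lambda>\<tau>. P \<tau> $$ ij)) * R)"
proof -
  \<comment> \<open>Written out in entries, the form is linear in Q, so the mean may be taken entry
    by entry, as in \<open>exp_bcirc_proj\<close>.\<close>
  have expand: "frob_inner R (Q * R) = (\<Sum>i<N. \<Sum>j<l. \<Sum>k<N. R $$ (i, j) * R $$ (k, j) * Q $$ (i, k))"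
    if "Q \<in> carrier_mat N N" for Q
    using that R by (simp add: frob_inner_def scalar_prod_def lessThan_atLeast0 sum_distrib_left ac_simps)
  have int: "integrable (measure_pmf D) f" for f :: "'a \<Rightarrow> real"
    by (rule integrable_measure_pmf_finite[OF fin])
  have "measure_pmf.expectation D (\<lambda>\<tau>. frob_inner R (P \<tau> * R)) =
    measure_pmf.expectation D (\<lambda>\<tau>. \<Sum>i<N. \<Sum>j<l. \<Sum>k<N. R $$ (i, j) * R $$ (k, j) * P \<tau> $$ (i, k))"
    by (intro integral_cong_AE AE_pmfI) (simp_all add: expand[OF P])
  also have "\<dots> = (\<Sum>i<N. \<Sum>j<l. \<Sum>k<N. R $$ (i, j) * R $$ (k, j) * measure_pmf.expectation D (\<lambda>\<tau>. P \<tau> $$ (i, k)))"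
    by (simp add: Bochner_Integration.integral_sum[OF int])
  also have "\<dots> = frob_inner R (Matrix.mat N N (\<lambda>ij. measure_pmf.expectation D (\<lambda>\<tau>. P \<tau> $$ ij)) * R)"
    by (subst expand) auto
  finally show ?thesis .
qed

text \<open>Q inherits symmetry and 0 \<le> Q \<le> I from the projections. The lower half makes the
  quadratic-form bound applicable, the upper half caps \<open>sigma_min Q\<close>.\<close>

lemma mean_projection_bounds:
  fixes D :: "'a pmf" and P :: "'a \<Rightarrow> real mat"
  assumes N: "0 < N" and fin: "finite (set_pmf D)"
    and P: "\<And>\<tau>. \<tau> \<in> set_pmf D \<Longrightarrow> P \<tau> \<in> carrier_mat N N"
      "\<And>\<tau>. \<tau> \<in> set_pmf D \<Longrightarrow> transpose_mat (P \<tau>) = P \<tau>"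
      "\<And>\<tau>. \<tau> \<in> set_pmf D \<Longrightarrow> P \<tau> * P \<tau> = P \<tau>"
  defines "Q \<equiv> Matrix.mat N N (\<lambda>ij. measure_pmf.expectation D (\<lambda>\<tau>. P \<tau> $$ ij))"
  shows "R \<in> carrier_mat N l \<Longrightarrow> sigma_min Q * frob_inner R R \<le> frob_inner R (Q * R)"
    and "sigma_min Q \<le> 1"
proof -
  have int: "integrable (measure_pmf D) f" for f :: "'a \<Rightarrow> real"
    by (rule integrable_measure_pmf_finite[OF fin])
  have Q: "Q \<in> carrier_mat N N" by (simp add: Q_def)
  have sym: "transpose_mat Q = Q"
  proof (rule eq_matI)
    fix i j assume "i < dim_row Q" "j < dim_col Q"
    then have ij: "i < N" "j < N" using Q by auto
    have "P \<tau> $$ (j, i) = P \<tau> $$ (i, j)" if "\<tau> \<in> set_pmf D" for \<tau>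
      using P(1,2)[OF that] ij by (metis carrier_matD index_transpose_mat(1))
    then have "measure_pmf.expectation D (\<lambda>\<tau>. P \<tau> $$ (j, i)) = measure_pmf.expectation D (\<lambda>\<tau>. P \<tau> $$ (i, j))"
      by (intro integral_cong_AE AE_pmfI) auto
    then show "transpose_mat Q $$ (i, j) = Q $$ (i, j)" using ij by (simp add: Q_def)
  qed (use Q in auto)
  have nonneg: "0 \<le> frob_inner R (Q * R)" and le: "frob_inner R (Q * R) \<le> frob_inner R R"
    if R: "R \<in> carrier_mat N l" for R l
  proof -
    have b: "0 \<le> frob_inner R (P \<tau> * R)" "frob_inner R (P \<tau> * R) \<le> frob_inner R R" if "\<tau> \<in> set_pmf D" for \<tau>
      using frob_inner_proj[OF P[OF that] R] frob_inner_self_nonneg[of "P \<tau> * R"]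
        frob_inner_self_nonneg[of "R - P \<tau> * R"] by auto
    have E: "frob_inner R (Q * R) = measure_pmf.expectation D (\<lambda>\<tau>. frob_inner R (P \<tau> * R))"
      unfolding Q_def by (rule expectation_frob_inner[OF fin P(1) R, symmetric])
    show "0 \<le> frob_inner R (Q * R)"
      unfolding E by (intro integral_nonneg_AE AE_pmfI b)
    have "measure_pmf.expectation D (\<lambda>\<tau>. frob_inner R (P \<tau> * R)) \<le> measure_pmf.expectation D (\<lambda>_. frob_inner R R)"
      by (intro integral_mono_AE int AE_pmfI b)
    then show "frob_inner R (Q * R) \<le> frob_inner R R" by (simp add: E)
  qed
  have psd: "0 \<le> scalar_prod x (Q *\<^sub>v x)" if x: "x \<in> carrier_vec N" for x
  proof -
    \<comment> \<open>The vector x as a one-column matrix, so that the Frobenius bound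
      \<open>nonneg\<close> applies to it.\<close>
    define X where "X = Matrix.mat N 1 (\<lambda>(i, j). vec_index x i)"
    have X: "X \<in> carrier_mat N 1" and c: "col X 0 = x" using x by (auto simp: X_def intro: eq_vecI)
    have "frob_inner X (Q * X) = scalar_prod x (Q *\<^sub>v x)"
      using frob_inner_col[OF X mult_carrier_mat[OF Q X]] by (simp add: col_mult2[OF Q X] c del: col_mult)
    then show ?thesis using nonneg[OF X] by simp
  qed
  show lower: "sigma_min Q * frob_inner R R \<le> frob_inner R (Q * R)" if "R \<in> carrier_mat N l" for R l
    by (rule frob_inner_sigma_min[OF N Q sym psd that])
  \<comment> \<open>A nonzero test column: comparing the lower and upper bounds on it and cancelling
    its squared norm N leaves \<open>sigma_min Q\<close> at most 1.\<close>
  define X where "X = Matrix.mat N 1 (\<lambda>_. 1 :: real)"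
  have X: "X \<in> carrier_mat N 1" by (simp add: X_def)
  have "frob_inner X X = real N" by (simp add: X_def frob_inner_def)
  then have "sigma_min Q * real N \<le> 1 * real N" using lower[OF X] le[OF X] by simp
  then show "sigma_min Q \<le> 1" using N by (simp only: mult_le_cancel_right_pos of_nat_0_less_iff)
qed

text \<open>This is alpha \<ge> 0, which licenses multiplying inequalities by alpha and its powers.
  With m = 0 the averaged matrix would be empty and \<open>sigma_min\<close> unspecified.\<close>

lemma sigma_min_exp_bcirc_proj_le_1:
  assumes p: "0 < p" and A: "is_tensor A m n p" and m: "0 < m" and fin: "finite (set_pmf D)"
    and inv: "\<And>\<tau>. \<tau> \<in> set_pmf D \<Longrightarrow> tinvertible (ttrans (sub_cols A \<tau>) \<star> sub_cols A \<tau>)"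
  shows "sigma_min (exp_bcirc_proj A D) \<le> 1"
proof -
  have dims: "dim_row (A ! 0) = m" "length A = p"
    using is_tensorD(1)[OF A] is_tensorD(2)[OF A p] by auto
  show ?thesis
    using mean_projection_bounds(2)[OF _ fin bcirc_proj_t_projection[OF p A inv]] m p
    by (simp add: exp_bcirc_proj_def Let_def dims)
qed

section \<open>Iterating the expected decrease\<close>

lemma trbgs_dist_support:
  assumes p: "0 < p" and A: "is_tensor A m n p" and B: "is_tensor B m l p" and X0: "is_tensor X0 n l p"
    and fin: "finite (set_pmf D)"
    and inv: "\<And>\<tau>. \<tau> \<in> set_pmf D \<Longrightarrow> tinvertible (ttrans (sub_cols A \<tau>) \<star> sub_cols A \<tau>)"
  shows "finite (set_pmf (trbgs_dist A B D X0 k))"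
    and "X \<in> set_pmf (trbgs_dist A B D X0 k) \<Longrightarrow> is_tensor X n l p"
proof -
  show "finite (set_pmf (trbgs_dist A B D X0 k))" by (induction k) (simp_all add: fin)
  show "X \<in> set_pmf (trbgs_dist A B D X0 k) \<Longrightarrow> is_tensor X n l p"
    by (induction k arbitrary: X) (auto simp: X0 intro!: trbgs_step_tensor[OF p A B inv])
qed

text \<open>The estimate conditional on the current X. Independence of the next block enters only
  later, through the bind in \<open>trbgs_dist\<close>, which draws from the same D whatever X
  is.\<close>

lemma trbgs_step_expected_error:
  assumes p: "0 < p" and A: "is_tensor A m n p" and B: "is_tensor B m l p"
    and fin: "finite (set_pmf D)"
    and sub: "\<And>\<tau>. \<tau> \<in> set_pmf D \<Longrightarrow> \<tau> \<subseteq> {0..<n}"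
    and inv: "\<And>\<tau>. \<tau> \<in> set_pmf D \<Longrightarrow> tinvertible (ttrans (sub_cols A \<tau>) \<star> sub_cols A \<tau>)"
    and Y: "is_tensor Y n l p"
    and normal: "transpose_mat (bcirc A) * (bcirc A * unfold_t Y - unfold_t B) = 0\<^sub>m (n * p) l"
    and X: "is_tensor X n l p"
    and m: "0 < m"
  shows "measure_pmf.expectation D (\<lambda>\<tau>. fro2 (tsub (A \<star> trbgs_step A B X \<tau>) (A \<star> Y)))
    \<le> (1 - sigma_min (exp_bcirc_proj A D)) * fro2 (tsub (A \<star> X) (A \<star> Y))"
proof -
  have int: "integrable (measure_pmf D) f" for f :: "nat set \<Rightarrow> real"
    by (rule integrable_measure_pmf_finite[OF fin])
  note AX = tprod_tensor[OF p A X] and AY = tprod_tensor[OF p A Y]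
  have dims: "dim_row (A ! 0) = m" "length A = p"
    using is_tensorD(1)[OF A] is_tensorD(2)[OF A p] by auto
  define R where "R = unfold_t (tsub (A \<star> X) (A \<star> Y))"
  define z where "z = bcirc A * unfold_t Y - unfold_t B"
  define Q where "Q = exp_bcirc_proj A D"
  have R: "R \<in> carrier_mat (m * p) l"
    unfolding R_def by (rule unfold_carrier[OF p tsub_tensor[OF AX AY]])
  have MX: "bcirc A * unfold_t X \<in> carrier_mat (m * p) l"
    and MY: "bcirc A * unfold_t Y \<in> carrier_mat (m * p) l"
    using bcirc_carrier[OF p A] unfold_carrier[OF p X] unfold_carrier[OF p Y] by auto
  have b: "unfold_t B \<in> carrier_mat (m * p) l" by (rule unfold_carrier[OF p B])
  have z: "z \<in> carrier_mat (m * p) l" unfolding z_def using b by (rule minus_carrier_mat)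
  have R_eq: "R = bcirc A * unfold_t X - bcirc A * unfold_t Y"
    by (simp add: R_def unfold_tsub[OF p AX AY] unfold_tprod[OF p A X] unfold_tprod[OF p A Y])
  note proj = bcirc_proj_t_projection[OF p A inv]
  have step: "fro2 (tsub (A \<star> trbgs_step A B X \<tau>) (A \<star> Y))
      = frob_inner R R - frob_inner R (bcirc (proj_t A \<tau>) * R)" if \<tau>: "\<tau> \<in> set_pmf D" for \<tau>
  proof -
    let ?P = "bcirc (proj_t A \<tau>)"
    let ?X = "trbgs_step A B X \<tau>"
    have X': "is_tensor ?X n l p" by (rule trbgs_step_tensor[OF p A B inv[OF \<tau>] X])
    note AX' = tprod_tensor[OF p A X']
    have P: "?P \<in> carrier_mat (m * p) (m * p)" by (rule proj(1)[OF \<tau>])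
    have PR: "?P * R \<in> carrier_mat (m * p) l" using P R by auto
    \<comment> \<open>The method sees only the full residual; it splits into the part R to be
      reduced and the optimal residual z, which P annihilates.\<close>
    have "bcirc A * unfold_t X - unfold_t B = R + z"
      unfolding R_eq z_def by (rule mat_diff_split[OF MX MY b])
    then have "?P * (bcirc A * unfold_t X - unfold_t B) = ?P * R + ?P * z"
      using mult_add_distrib_mat[OF P R z] by simp
    also have "?P * z = 0\<^sub>m (m * p) l"
      using bcirc_proj_t_annihilates[OF p A sub[OF \<tau>] inv[OF \<tau>] z] normal by (simp add: z_def)
    finally have PD: "?P * (bcirc A * unfold_t X - unfold_t B) = ?P * R" using PR by simp
    have "unfold_t (tsub (A \<star> ?X) (A \<star> Y)) = bcirc A * unfold_t X - ?P * R - bcirc A * unfold_t Y"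
      by (simp add: unfold_tsub[OF p AX' AY] unfold_tprod[OF p A X'] unfold_tprod[OF p A Y]
          trbgs_step_residual[OF p A B sub[OF \<tau>] inv[OF \<tau>] X] PD)
    also have "\<dots> = R - ?P * R" unfolding R_eq by (rule mat_diff_diff_commute[OF MX _ MY]) (use PR in \<open>simp add: R_eq\<close>)
    finally show ?thesis
      using fro2_unfold[OF p tsub_tensor[OF AX' AY]] frob_inner_proj(2)[OF proj[OF \<tau>] R] by simp
  qed
  have Q_eq: "Q = Matrix.mat (m * p) (m * p) (\<lambda>ij. measure_pmf.expectation D (\<lambda>\<tau>. bcirc (proj_t A \<tau>) $$ ij))"
    by (simp add: Q_def exp_bcirc_proj_def Let_def dims)
  have "measure_pmf.expectation D (\<lambda>\<tau>. fro2 (tsub (A \<star> trbgs_step A B X \<tau>) (A \<star> Y)))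
     = measure_pmf.expectation D (\<lambda>\<tau>. frob_inner R R - frob_inner R (bcirc (proj_t A \<tau>) * R))"
    by (intro integral_cong_AE AE_pmfI) (simp_all add: step)
  also have "\<dots> = frob_inner R R - frob_inner R (Q * R)"
    using expectation_frob_inner[OF fin proj(1) R] by (simp add: int Q_eq)
  also have "\<dots> \<le> frob_inner R R - sigma_min Q * frob_inner R R"
    using mean_projection_bounds(1)[OF _ fin proj R] p m by (simp add: Q_eq)
  also have "\<dots> = (1 - sigma_min Q) * fro2 (tsub (A \<star> X) (A \<star> Y))"
    using fro2_unfold[OF p tsub_tensor[OF AX AY]] by (simp add: R_def algebra_simps)
  finally show ?thesis by (simp add: Q_def)
qed

lemma trbgs_dist_expected_error:
  assumes p: "0 < p" and A: "is_tensor A m n p" and B: "is_tensor B m l p"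
    and fin: "finite (set_pmf D)"
    and sub: "\<And>\<tau>. \<tau> \<in> set_pmf D \<Longrightarrow> \<tau> \<subseteq> {0..<n}"
    and inv: "\<And>\<tau>. \<tau> \<in> set_pmf D \<Longrightarrow> tinvertible (ttrans (sub_cols A \<tau>) \<star> sub_cols A \<tau>)"
    and Y: "is_tensor Y n l p"
    and normal: "transpose_mat (bcirc A) * (bcirc A * unfold_t Y - unfold_t B) = 0\<^sub>m (n * p) l"
    and X0: "is_tensor X0 n l p"
  shows "measure_pmf.expectation (trbgs_dist A B D X0 k) (\<lambda>X. fro2 (tsub (A \<star> X) (A \<star> Y)))
    \<le> (1 - sigma_min (exp_bcirc_proj A D)) ^ k * fro2 (tsub (A \<star> X0) (A \<star> Y))"
proof (cases "m = 0")
  case True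
  \<comment> \<open>The sign of alpha is unknown here, but with no rows both sides of the claim are
    0.\<close>
  have zero: "fro2 (tsub (A \<star> X) (A \<star> Y)) = 0" if X: "is_tensor X n l p" for X
    using fro2_empty[OF p tsub_tensor[OF tprod_tensor[OF p A X] tprod_tensor[OF p A Y]]] True by simp
  have "measure_pmf.expectation (trbgs_dist A B D X0 k) (\<lambda>X. fro2 (tsub (A \<star> X) (A \<star> Y))) = 0"
    by (intro integral_eq_zero_AE AE_pmfI zero) (rule trbgs_dist_support(2)[OF p A B X0 fin inv])
  then show ?thesis by (simp add: zero[OF X0])
next
  case False
  let ?e = "\<lambda>X. fro2 (tsub (A \<star> X) (A \<star> Y))"
  let ?\<alpha> = "1 - sigma_min (exp_bcirc_proj A D)"
  have "0 \<le> ?\<alpha>" using sigma_min_exp_bcirc_proj_le_1[OF p A _ fin inv] False by simp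
  show ?thesis
  proof (induction k)
    case (Suc k)
    let ?T = "trbgs_dist A B D X0 k"
    note supp = trbgs_dist_support[OF p A B X0 fin inv, where k = k]
    \<comment> \<open>Law of total expectation: the bind becomes a finite weighted sum over the
      possible values of the k-th iterate.\<close>
    have "measure_pmf.expectation (trbgs_dist A B D X0 (Suc k)) ?e =
      (\<Sum>X\<in>set_pmf ?T. pmf ?T X * measure_pmf.expectation D (\<lambda>\<tau>. ?e (trbgs_step A B X \<tau>)))"
      using supp(1) fin by (simp add: pmf_expectation_bind[of "set_pmf ?T"])
    also have "\<dots> \<le> (\<Sum>X\<in>set_pmf ?T. pmf ?T X * (?\<alpha> * ?e X))"
      using supp(2) False
      by (intro sum_mono mult_left_mono trbgs_step_expected_error[OF p A B fin sub inv Y normal]) auto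
    also have "\<dots> = ?\<alpha> * measure_pmf.expectation ?T ?e"
      using supp(1) by (simp add: integral_measure_pmf[of "set_pmf ?T"] sum_distrib_left ac_simps)
    also have "\<dots> \<le> ?\<alpha> * (?\<alpha> ^ k * ?e X0)"
      using Suc \<open>0 \<le> ?\<alpha>\<close> by (rule mult_left_mono)
    finally show ?case by simp
  qed simp
qed

section \<open>From residuals to errors when the solution is unique\<close>

lemma unique_solution_injective:
  assumes p: "0 < p" and l: "0 < l" and A: "is_tensor A m n p" and Y: "is_tensor Y n l p"
    and uniq: "\<And>X. is_tensor X n l p \<Longrightarrow> A \<star> X = A \<star> Y \<Longrightarrow> X = Y"
    and v: "v \<in> carrier_vec (n * p)" "bcirc A *\<^sub>v v = 0\<^sub>v (m * p)"
  shows "v = 0\<^sub>v (n * p)"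
proof -
  note M = bcirc_carrier[OF p A] and U = unfold_carrier[OF p Y]
  \<comment> \<open>Uniqueness concerns tensors with l columns, so the kernel vector v is copied
    into each of them. Then Y plus V is a second solution, and v is read off column 0, which exists
    because l > 0.\<close>
  define V where "V = Matrix.mat (n * p) l (\<lambda>(i, j). vec_index v i)"
  have V: "V \<in> carrier_mat (n * p) l" by (simp add: V_def)
  have MV: "bcirc A * V = 0\<^sub>m (m * p) l"
  proof (rule mat_col_eqI)
    fix j assume "j < dim_col (0\<^sub>m (m * p) l :: real mat)"
    then have j: "j < l" by simp
    have "col V j = v" by (rule eq_vecI) (use j v(1) in \<open>simp_all add: V_def\<close>)
    then show "col (bcirc A * V) j = col (0\<^sub>m (m * p) l) j"
      using j v(2) by (simp add: col_mult2[OF M V j] del: col_mult)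
  qed (use M V in auto)
  define X where "X = fold_t (unfold_t Y + V) p"
  have UV: "unfold_t Y + V \<in> carrier_mat (n * p) l" using U V by auto
  have X: "is_tensor X n l p" unfolding X_def by (rule fold_tensor[OF p UV])
  have unfX: "unfold_t X = unfold_t Y + V" unfolding X_def by (rule unfold_fold[OF p UV])
  have "unfold_t (A \<star> X) = bcirc A * unfold_t Y + 0\<^sub>m (m * p) l"
    unfolding unfold_tprod[OF p A X] unfX mult_add_distrib_mat[OF M U V] MV ..
  also have "\<dots> = unfold_t (A \<star> Y)"
    unfolding unfold_tprod[OF p A Y] by (rule right_add_zero_mat[OF mult_carrier_mat[OF M U]])
  finally have "A \<star> X = A \<star> Y"
    by (rule unfold_inj[OF tprod_tensor[OF p A X] tprod_tensor[OF p A Y]])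
  then have "X = Y" by (rule uniq[OF X])
  have eq: "unfold_t Y + V = unfold_t Y" by (rule unfX[unfolded \<open>X = Y\<close>, symmetric])
  show ?thesis
  proof (rule eq_vecI)
    fix i assume "i < dim_vec (0\<^sub>v (n * p) :: real Matrix.vec)"
    then have i: "i < n * p" by simp
    have "(unfold_t Y + V) $$ (i, 0) = unfold_t Y $$ (i, 0)" by (simp add: eq)
    then show "vec_index v i = vec_index (0\<^sub>v (n * p)) i" using i l U by (simp add: V_def)
  qed (use v in simp)
qed

theorem theorem1:
  fixes A B X0 Xdd :: tensor and m n l p :: nat and T :: "nat set set" and D :: "nat set pmf"
  assumes p_pos: "0 < p"
    and A_dim: "is_tensor A m n p"
    and B_dim: "is_tensor B m l p"
    and X0_dim: "is_tensor X0 n l p"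
    and T_fin: "finite T"
    and T_sub: "\<forall>\<tau>\<in>T. \<tau> \<subseteq> {0..<n}"
    and T_inv: "\<forall>\<tau>\<in>T. tinvertible (ttrans (sub_cols A \<tau>) \<star> sub_cols A \<tau>)"
    and D_T: "set_pmf D \<subseteq> T"
    and Xdd_dim: "is_tensor Xdd n l p"
    and Xdd_min: "\<forall>X. is_tensor X n l p \<longrightarrow> fro2 (tsub (A \<star> Xdd) B) \<le> fro2 (tsub (A \<star> X) B)"
  shows "(\<forall>k. measure_pmf.expectation (trbgs_dist A B D X0 k)
                (\<lambda>X. fro2 (tsub (A \<star> X) (A \<star> Xdd)))
            \<le> (1 - sigma_min (exp_bcirc_proj A D)) ^ k * fro2 (tsub (A \<star> X0) (A \<star> Xdd)))
       \<and> ((\<forall>X. is_tensor X n l p \<longrightarrow> A \<star> X = A \<star> Xdd \<longrightarrow> X = Xdd) \<longrightarrow>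
          (\<forall>k. measure_pmf.expectation (trbgs_dist A B D X0 k) (\<lambda>X. fro2 (tsub X Xdd))
            \<le> (sigma_max (pinv (bcirc A)))\<^sup>2 * (sigma_max (bcirc A))\<^sup>2
               * (1 - sigma_min (exp_bcirc_proj A D)) ^ k * fro2 (tsub X0 Xdd)))"
proof -
  note M = bcirc_carrier[OF p_pos A_dim]
  have fin: "finite (set_pmf D)" using T_fin D_T finite_subset by blast
  have sub: "\<tau> \<subseteq> {0..<n}" if "\<tau> \<in> set_pmf D" for \<tau> using that T_sub D_T by blast
  have inv: "tinvertible (ttrans (sub_cols A \<tau>) \<star> sub_cols A \<tau>)" if "\<tau> \<in> set_pmf D" for \<tau>
    using that T_inv D_T by blast
  have fro2_residual: "fro2 (tsub (A \<star> X) B)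
      = frob_inner (bcirc A * unfold_t X - unfold_t B) (bcirc A * unfold_t X - unfold_t B)"
    if "is_tensor X n l p" for X
  proof -
    note AX = tprod_tensor[OF p_pos A_dim that]
    show ?thesis
      by (simp add: fro2_unfold[OF p_pos tsub_tensor[OF AX B_dim]] unfold_tsub[OF p_pos AX B_dim]
          unfold_tprod[OF p_pos A_dim that])
  qed
  have normal: "transpose_mat (bcirc A) * (bcirc A * unfold_t Xdd - unfold_t B) = 0\<^sub>m (n * p) l"
  proof (rule least_squares_normal_equation[OF M unfold_carrier[OF p_pos Xdd_dim] unfold_carrier[OF p_pos B_dim]])
    \<comment> \<open>Every matrix of the right size is the unfolding of a tensor, so minimality
      over tensors is minimality over all V.\<close>
    fix V :: "real mat" assume V: "V \<in> carrier_mat (n * p) l"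
    show "frob_inner (bcirc A * unfold_t Xdd - unfold_t B) (bcirc A * unfold_t Xdd - unfold_t B)
      \<le> frob_inner (bcirc A * V - unfold_t B) (bcirc A * V - unfold_t B)"
      using Xdd_min[rule_format, OF fold_tensor[OF p_pos V]]
      unfolding fro2_residual[OF Xdd_dim] fro2_residual[OF fold_tensor[OF p_pos V]] unfold_fold[OF p_pos V] .
  qed
  have rate: "measure_pmf.expectation (trbgs_dist A B D X0 k) (\<lambda>X. fro2 (tsub (A \<star> X) (A \<star> Xdd)))
      \<le> (1 - sigma_min (exp_bcirc_proj A D)) ^ k * fro2 (tsub (A \<star> X0) (A \<star> Xdd))" for k
    by (rule trbgs_dist_expected_error[OF p_pos A_dim B_dim fin sub inv Xdd_dim normal X0_dim])
  have "measure_pmf.expectation (trbgs_dist A B D X0 k) (\<lambda>X. fro2 (tsub X Xdd))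
     \<le> (sigma_max (pinv (bcirc A)))\<^sup>2 * (sigma_max (bcirc A))\<^sup>2
         * (1 - sigma_min (exp_bcirc_proj A D)) ^ k * fro2 (tsub X0 Xdd)"
    if uniq: "\<forall>X. is_tensor X n l p \<longrightarrow> A \<star> X = A \<star> Xdd \<longrightarrow> X = Xdd" for k
  proof (cases "l = 0")
    case True
    \<comment> \<open>Without columns, uniqueness holds trivially and gives no injectivity of
      \<open>bcirc A\<close>, so this case cannot go through the pseudoinverse.\<close>
    have zero: "fro2 (tsub X Xdd) = 0" if "is_tensor X n l p" for X
      using fro2_empty[OF p_pos tsub_tensor[OF that Xdd_dim]] True by simp
    have "measure_pmf.expectation (trbgs_dist A B D X0 k) (\<lambda>X. fro2 (tsub X Xdd)) = 0"
      by (intro integral_eq_zero_AE AE_pmfI zero)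
        (rule trbgs_dist_support(2)[OF p_pos A_dim B_dim X0_dim fin inv])
    then show ?thesis by (simp add: zero[OF X0_dim])
  next
    case False
    let ?G = "pinv (bcirc A)" and ?T = "trbgs_dist A B D X0 k"
    let ?\<alpha> = "1 - sigma_min (exp_bcirc_proj A D)"
    have inj: "v = 0\<^sub>v (n * p)" if "v \<in> carrier_vec (n * p)" "bcirc A *\<^sub>v v = 0\<^sub>v (m * p)" for v
    proof (rule unique_solution_injective[OF p_pos _ A_dim Xdd_dim _ that])
      show "0 < l" using False by simp
      show "X = Xdd" if "is_tensor X n l p" "A \<star> X = A \<star> Xdd" for X
        using uniq that by (elim allE impE)
    qed
    note G = pinv_left_inverse[OF M inj]
    have image: "fro2 (tsub (A \<star> X) (A \<star> Xdd))
        = frob_inner (bcirc A * unfold_t (tsub X Xdd)) (bcirc A * unfold_t (tsub X Xdd))"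
      if X: "is_tensor X n l p" for X
    proof -
      note AX = tprod_tensor[OF p_pos A_dim X] and AY = tprod_tensor[OF p_pos A_dim Xdd_dim]
      show ?thesis
        by (simp add: fro2_unfold[OF p_pos tsub_tensor[OF AX AY]] unfold_tsub[OF p_pos AX AY]
          unfold_tsub[OF p_pos X Xdd_dim] unfold_tprod[OF p_pos A_dim X] unfold_tprod[OF p_pos A_dim Xdd_dim]
          mult_minus_distrib_mat[OF M unfold_carrier[OF p_pos X] unfold_carrier[OF p_pos Xdd_dim]])
    qed
    have lower: "fro2 (tsub X Xdd) \<le> (sigma_max ?G)\<^sup>2 * fro2 (tsub (A \<star> X) (A \<star> Xdd))"
      if X: "is_tensor X n l p" for X
    proof -
      note t = tsub_tensor[OF X Xdd_dim]
      note W = unfold_carrier[OF p_pos t]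
      have "?G * (bcirc A * unfold_t (tsub X Xdd)) = unfold_t (tsub X Xdd)"
        using assoc_mult_mat[OF G(1) M W] G(2) W by simp
      then show ?thesis
        using frob_inner_sigma_max[OF G(1) mult_carrier_mat[OF M W]]
        by (simp add: image[OF X] fro2_unfold[OF p_pos t])
    qed
    have "measure_pmf.expectation ?T (\<lambda>X. fro2 (tsub X Xdd))
      \<le> measure_pmf.expectation ?T (\<lambda>X. (sigma_max ?G)\<^sup>2 * fro2 (tsub (A \<star> X) (A \<star> Xdd)))"
      using trbgs_dist_support(1)[OF p_pos A_dim B_dim X0_dim fin inv]
      by (intro integral_mono_AE integrable_measure_pmf_finite AE_pmfI lower
          trbgs_dist_support(2)[OF p_pos A_dim B_dim X0_dim fin inv])
    also have "\<dots> = (sigma_max ?G)\<^sup>2 * measure_pmf.expectation ?T (\<lambda>X. fro2 (tsub (A \<star> X) (A \<star> Xdd)))"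
      by simp
    also have "\<dots> \<le> (sigma_max ?G)\<^sup>2 * (?\<alpha> ^ k * fro2 (tsub (A \<star> X0) (A \<star> Xdd)))"
      by (intro mult_left_mono rate) simp
    also have "\<dots> \<le> (sigma_max ?G)\<^sup>2 * (?\<alpha> ^ k * ((sigma_max (bcirc A))\<^sup>2 * fro2 (tsub X0 Xdd)))"
    proof (cases "m = 0")
      case True
      \<comment> \<open>With alpha of unknown sign the comparison cannot be multiplied by its power.
        Instead \<open>lower\<close> shows that the initial error vanishes along with the empty
        residual, so both sides are 0.\<close>
      have zero: "fro2 (tsub (A \<star> X0) (A \<star> Xdd)) = 0"
        using True fro2_empty[OF p_pos tsub_tensor[OF tprod_tensor[OF p_pos A_dim X0_dim]
              tprod_tensor[OF p_pos A_dim Xdd_dim]]] by simp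
      moreover have "0 \<le> fro2 (tsub X0 Xdd)"
        by (simp add: fro2_unfold[OF p_pos tsub_tensor[OF X0_dim Xdd_dim]] frob_inner_self_nonneg)
      ultimately have "fro2 (tsub X0 Xdd) = 0" using lower[OF X0_dim] by simp
      then show ?thesis using zero by simp
    next
      case False
      then have "0 \<le> ?\<alpha>" using sigma_min_exp_bcirc_proj_le_1[OF p_pos A_dim _ fin inv] by simp
      moreover have "fro2 (tsub (A \<star> X0) (A \<star> Xdd)) \<le> (sigma_max (bcirc A))\<^sup>2 * fro2 (tsub X0 Xdd)"
        unfolding image[OF X0_dim] fro2_unfold[OF p_pos tsub_tensor[OF X0_dim Xdd_dim]]
        by (rule frob_inner_sigma_max[OF M unfold_carrier[OF p_pos tsub_tensor[OF X0_dim Xdd_dim]]])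
      ultimately show ?thesis by (intro mult_left_mono) auto
    qed
    finally show ?thesis by (simp add: ac_simps)
  qed
  with rate show ?thesis by blast
qed

end
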